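(* $\gamma^+(c)$ is in $C^\infty(J\setminus\{c: c_1=-1\})$, and $\gamma^+(-1,c_2,c_3)$, as a function of $(c_2,c_3)$, is in $C^\infty(J\cap\{c:c_1=-1\})$. Likewise $\gamma^-(c)$ is in $C^\infty(J\setminus\{c:c_2=-1\})$, and $\gamma^-(c_1,-1,c_3)$, as a function of $(c_1,c_3)$, is in $C^\infty(J\cap\{c:c_2=-1\})$.
   Context: For $c=(c_1,c_2,c_3)\in\mathbb{R}^3$ let $P_c(x):=c_1(1-x)+c_2(1+x)+c_3(1-x^2)$ and consider the ODE $(1-x^2)U'+2xU+\frac12U^2=P_c(x)$ on $(-1,1)$. For $c_1,c_2\ge-1$ let $\bar c_3(c_1,c_2):=-\frac12(\sqrt{1+c_1}+\sqrt{1+c_2})(\sqrt{1+c_1}+\sqrt{1+c_2}+2)$ and $J:=\{c: c_1\ge-1,c_2\ge-1,c_3\ge\bar c_3(c_1,c_2)\}$. For $c\in J$ the ODE has solutions on $(-1,1)$, and there are a largest solution $U^+_\theta(c)$ and a smallest solution $U^-_\theta(c)$ (i.e. $U^-_\theta(c)\le U\le U^+_\theta(c)$ for every solution $U$ on $(-1,1)$). Define $\gamma^\pm(c):=U^\pm_\theta(c)(0)$. *)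

theory Defs
  imports "HOL-Analysis.Analysis"
begin

definition Pc :: "real \<times> real \<times> real \<Rightarrow> real \<Rightarrow> real" where
  "Pc c x = fst c * (1 - x) + fst (snd c) * (1 + x) + snd (snd c) * (1 - x\<^sup>2)"

definition is_sol :: "real \<times> real \<times> real \<Rightarrow> (real \<Rightarrow> real) \<Rightarrow> bool" where
  "is_sol c U \<longleftrightarrow> (\<forall>x\<in>{-1<..<1}. \<exists>d. (U has_real_derivative d) (at x) \<and>
      (1 - x\<^sup>2) * d + 2 * x * U x + (U x)\<^sup>2 / 2 = Pc c x)"

definition c3bar :: "real \<Rightarrow> real \<Rightarrow> real" where
  "c3bar c1 c2 = - (1/2) * (sqrt (1 + c1) + sqrt (1 + c2)) * (sqrt (1 + c1) + sqrt (1 + c2) + 2)"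

definition Jset :: "(real \<times> real \<times> real) set" where
  "Jset = {(c1, c2, c3). c1 \<ge> -1 \<and> c2 \<ge> -1 \<and> c3 \<ge> c3bar c1 c2}"

definition gamma_plus :: "real \<times> real \<times> real \<Rightarrow> real" where
  "gamma_plus c = (THE g. \<exists>U. is_sol c U \<and>
      (\<forall>V. is_sol c V \<longrightarrow> (\<forall>x\<in>{-1<..<1}. V x \<le> U x)) \<and> U 0 = g)"

definition gamma_minus :: "real \<times> real \<times> real \<Rightarrow> real" where
  "gamma_minus c = (THE g. \<exists>U. is_sol c U \<and>
      (\<forall>V. is_sol c V \<longrightarrow> (\<forall>x\<in>{-1<..<1}. U x \<le> V x)) \<and> U 0 = g)"

fun Ck :: "nat \<Rightarrow> ('a::euclidean_space \<Rightarrow> real) \<Rightarrow> 'a set \<Rightarrow> bool" where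
  "Ck 0 f S = continuous_on S f"
| "Ck (Suc k) f S = (\<exists>f'. (\<forall>x\<in>S. (f has_derivative f' x) (at x)) \<and>
                          (\<forall>i\<in>Basis. Ck k (\<lambda>x. f' x i) S))"

definition smooth_on :: "'a set \<Rightarrow> ('a::euclidean_space \<Rightarrow> real) \<Rightarrow> bool" where
  "smooth_on S f \<longleftrightarrow> (\<forall>p\<in>S. \<exists>N g. open N \<and> p \<in> N \<and> (\<forall>k. Ck k g N) \<and>
      (\<forall>q\<in>S \<inter> N. g q = f q))"

end

(* With t = 1 + x, the substitution U = 2 (1 - x^2) phi'/phi linearises the equation to
   phi'' = P_c / (2 (1 - x^2)^2) phi, which has a regular singular point at x = -1 with exponents
   (1 +- a)/2, a = sqrt (1 + c_1).  The largest solution U comes from the recessive Frobenius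
   solution phi = t^((1+a)/2) * (SUM n. a_n t^n): for another solution V with V > U somewhere,
   E = (V - U) phi^2 / (1 - x^2) satisfies (1/E)' = 1/(2 phi^2), and 1/phi^2 is not integrable
   at x = -1.  On J the power series is positive by comparison with the explicit solution
   (1+x)^((1+a)/2) (1-x)^((1+b)/2), b = sqrt (1 + c_2), for c_3 = c3bar.  Hence
   gamma^+ = 1 + a + 2 (SUM n. n a_n) / (SUM n. a_n), where a_n is rational in a and polynomial in c_2, c_3
   and the series converge locally uniformly for complex parameters; so gamma^+ extends to a
   continuous separately holomorphic function, whose partial derivatives are of the same kind.
   The reflection x -> -x exchanges c_1 and c_2 and reduces gamma^- to gamma^+. *)

theory Submission
  imports Defs "HOL-Complex_Analysis.Complex_Analysis"
begin

section \<open>Separately holomorphic functions\<close>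

text \<open>Smoothness is claimed up to the boundary of J, through local smooth extensions, whereas
  extremality and the sign of the power series are controlled only on J. The two demands separate:
  positivity on all of [0,2) identifies gamma^+ with the series formula on J, while extending that
  formula needs only a nonzero denominator at the single point t = 1, which is an open condition in
  the parameters. Differentiating a_n in the parameters and estimating the results is avoided:
  uniform bounds at complex parameters suffice, because uniform limits stay holomorphic and Cauchy
  estimates give continuous partial derivatives of every order. Continuity together with holomorphy
  in each variable keeps all complex analysis in one variable. Taking the larger exponent (1+a)/2
  turns the indicial factor into n (n + a), which never vanishes for n >= 1 and Re a >= 0; integer a
  therefore causes no resonance. The exceptional face c_1 = -1 is the branch point of a = sqrt (1 +
  c_1): off it a is holomorphic in c_1, and on it a = 0 is constant.\<close>

lemma holomorphic_linear_approx:
  fixes g :: "complex \<Rightarrow> complex"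
  assumes hol: "g holomorphic_on ball 0 R" and "R > 0"
    and bound: "\<And>z. z \<in> ball 0 R \<Longrightarrow> norm (g z) < B"
    and h: "norm h < R / 2"
  shows "norm (g h - g 0 - deriv g 0 * h) \<le> 32 * B / R\<^sup>2 * (norm h)\<^sup>2"
proof -
  \<comment> \<open>The disc of radius \<open>R/4\<close> about \<open>z\<close> stays in
    \<open>ball 0 R\<close>, and Cauchy's estimate on it gives 2! / (1/4)^2 = 32.\<close>
  have 2: "norm ((deriv ^^ 2) g z) \<le> 32 * B / R\<^sup>2" if "z \<in> ball 0 (R/2)" for z
  proof -
    have "cball z (R/4) \<subseteq> ball 0 R"
      using that \<open>R > 0\<close> by (auto simp: dist_norm subset_iff) (smt (verit) field_sum_of_halves norm_minus_commute norm_triangle_sub)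
    hence sub: "ball z (R/4) \<subseteq> ball 0 R" "cball z (R/4) \<subseteq> ball 0 R" by auto
    have "norm ((deriv ^^ 2) g z) \<le> fact 2 * B / (R/4) ^ 2"
    proof (rule Cauchy_higher_deriv_bound[where y = 0])
      show "g holomorphic_on ball z (R/4)" "continuous_on (cball z (R/4)) g"
        using hol sub holomorphic_on_subset holomorphic_on_imp_continuous_on by blast+
      show "g w \<in> ball 0 B" if "w \<in> ball z (R/4)" for w
        using bound[of w] that sub by auto
    qed (use \<open>R > 0\<close> in auto)
    thus ?thesis by (simp add: power_divide field_simps)
  qed
  have "norm (g h - (\<Sum>i\<le>1. (deriv ^^ i) g 0 * (h - 0) ^ i / fact i)) 
      \<le> 32 * B / R\<^sup>2 * norm (h - 0) ^ Suc 1 / fact 1"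
  proof (rule complex_Taylor[of "ball 0 (R/2)" 1 "\<lambda>i. (deriv ^^ i) g", simplified funpow_0])
    fix i :: nat and x :: complex assume x: "x \<in> ball 0 (R/2)"
    have "(deriv ^^ i) g holomorphic_on ball 0 R"
      by (intro holomorphic_higher_deriv hol) auto
    hence "((deriv ^^ i) g has_field_derivative deriv ((deriv ^^ i) g) x) (at x)"
      using x \<open>R > 0\<close> by (intro holomorphic_derivI[of _ "ball 0 R"]) auto
    thus "((deriv ^^ i) g has_field_derivative (deriv ^^ Suc i) g x) (at x within ball 0 (R/2))"
      by (simp add: has_field_derivative_at_within)
  qed (use \<open>R > 0\<close> h 2 in \<open>auto simp: numeral_2_eq_2\<close>)
  thus ?thesis by (simp add: algebra_simps power2_eq_square)
qed

text \<open>A point \<open>(x, y)\<close> of \<open>'a \<times> 'a\<close> encodes the complex vector \<open>x + \<i> y\<close>;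
  \<open>cdir b \<zeta>\<close> is then \<open>\<zeta> b\<close>.\<close>

definition cdir :: "'a::euclidean_space \<Rightarrow> complex \<Rightarrow> 'a \<times> 'a" where
  "cdir b \<zeta> = (Re \<zeta> *\<^sub>R b, Im \<zeta> *\<^sub>R b)"

lemma cdir_0 [simp]: "cdir b 0 = 0"
  by (simp add: cdir_def zero_prod_def)

lemma norm_cdir [simp]: "b \<in> Basis \<Longrightarrow> norm (cdir b z) = norm z"
  by (simp add: cdir_def norm_Pair cmod_def)

lemma continuous_cdir [continuous_intros]: "continuous_on A f \<Longrightarrow> continuous_on A (\<lambda>x. cdir b (f x))"
  unfolding cdir_def by (intro continuous_intros)

text \<open>On open \<open>D\<close> this is holomorphy in several variables, by Osgood's lemma. The
  base point \<open>p\<close> is arbitrary, since each slice is cut down to the preimage of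
  \<open>D\<close>; closure proofs thus carry no membership conditions on \<open>p\<close>.\<close>

definition sep_hol :: "('a::euclidean_space \<times> 'a) set \<Rightarrow> ('a \<times> 'a \<Rightarrow> complex) \<Rightarrow> bool" where
  "sep_hol D f \<longleftrightarrow> continuous_on D f \<and>
    (\<forall>p. \<forall>b\<in>Basis. (\<lambda>\<zeta>. f (p + cdir b \<zeta>)) holomorphic_on ((\<lambda>\<zeta>. p + cdir b \<zeta>) -` D))"

lemma sep_holI:
  assumes "continuous_on D f"
    and "\<And>p b. b \<in> Basis \<Longrightarrow> (\<lambda>\<zeta>. f (p + cdir b \<zeta>)) holomorphic_on ((\<lambda>\<zeta>. p + cdir b \<zeta>) -` D)"
  shows "sep_hol D f"
  using assms unfolding sep_hol_def by blast

lemma sep_hol_imp_continuous_on: "sep_hol D f \<Longrightarrow> continuous_on D f"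
  by (simp add: sep_hol_def)

lemma sep_hol_slice:
  "sep_hol D f \<Longrightarrow> b \<in> Basis \<Longrightarrow> (\<lambda>\<zeta>. f (p + cdir b \<zeta>)) holomorphic_on ((\<lambda>\<zeta>. p + cdir b \<zeta>) -` D)"
  unfolding sep_hol_def by blast

lemma open_slice: "open D \<Longrightarrow> open ((\<lambda>\<zeta>. p + cdir b \<zeta>) -` D)"
  by (rule open_vimage) (auto intro!: continuous_intros)

lemma sep_hol_subset: "sep_hol D f \<Longrightarrow> E \<subseteq> D \<Longrightarrow> sep_hol E f"
  unfolding sep_hol_def by (meson continuous_on_subset holomorphic_on_subset vimage_mono)

lemma sep_hol_local:
  assumes "\<And>p. p \<in> D \<Longrightarrow> \<exists>E. open E \<and> p \<in> E \<and> sep_hol E f"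
  shows "sep_hol D f"
proof (rule sep_holI)
  show "continuous_on D f"
    by (metis assms continuous_at_imp_continuous_on continuous_on_eq_continuous_at sep_hol_def)
next
  fix p :: "'a \<times> 'a" and b :: 'a assume b: "b \<in> Basis"
  show "(\<lambda>\<zeta>. f (p + cdir b \<zeta>)) holomorphic_on (\<lambda>\<zeta>. p + cdir b \<zeta>) -` D"
    unfolding holomorphic_on_def
  proof
    fix z assume "z \<in> (\<lambda>\<zeta>. p + cdir b \<zeta>) -` D"
    then obtain E where E: "open E" "p + cdir b z \<in> E" "sep_hol E f" using assms by blast
    hence "(\<lambda>\<zeta>. f (p + cdir b \<zeta>)) holomorphic_on (\<lambda>\<zeta>. p + cdir b \<zeta>) -` E"
      using b by (intro sep_hol_slice)
    thus "(\<lambda>\<zeta>. f (p + cdir b \<zeta>)) field_differentiable at z within (\<lambda>\<zeta>. p + cdir b \<zeta>) -` D"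
      using E open_slice[OF E(1)] by (metis field_differentiable_at_within holomorphic_on_imp_differentiable_at vimageI)
  qed
qed

lemma sep_hol_const: "sep_hol D (\<lambda>_. c)"
  by (auto intro!: sep_holI)

lemma sep_hol_add:
  assumes "sep_hol D f" "sep_hol D g"
  shows "sep_hol D (\<lambda>p. f p + g p)"
  by (rule sep_holI, rule continuous_on_add, (rule sep_hol_imp_continuous_on assms)+,
      rule holomorphic_on_add, (rule sep_hol_slice assms; assumption?)+)

lemma sep_hol_diff:
  assumes "sep_hol D f" "sep_hol D g"
  shows "sep_hol D (\<lambda>p. f p - g p)"
  by (rule sep_holI, rule continuous_on_diff, (rule sep_hol_imp_continuous_on assms)+,
      rule holomorphic_on_diff, (rule sep_hol_slice assms; assumption?)+)

lemma sep_hol_mult: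
  assumes "sep_hol D f" "sep_hol D g"
  shows "sep_hol D (\<lambda>p. f p * g p)"
  by (rule sep_holI, rule continuous_on_mult, (rule sep_hol_imp_continuous_on assms)+,
      rule holomorphic_on_mult, (rule sep_hol_slice assms; assumption?)+)

lemma sep_hol_divide:
  assumes "sep_hol D f" "sep_hol D g" "\<And>p. p \<in> D \<Longrightarrow> g p \<noteq> 0"
  shows "sep_hol D (\<lambda>p. f p / g p)"
  by (rule sep_holI, rule continuous_on_divide, (rule sep_hol_imp_continuous_on assms(1,2))+, use assms(3) in blast,
      rule holomorphic_on_divide, (rule sep_hol_slice assms(1,2); assumption?)+, use assms(3) in blast)

lemma sep_hol_sum:
  assumes "\<And>i. i \<in> I \<Longrightarrow> sep_hol D (f i)"
  shows "sep_hol D (\<lambda>p. \<Sum>i\<in>I. f i p)"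
  by (rule sep_holI, rule continuous_on_sum, (rule sep_hol_imp_continuous_on assms; assumption?)+,
      rule holomorphic_on_sum, (rule sep_hol_slice assms; assumption?)+)

lemma sep_hol_compose:
  assumes "sep_hol D f" "F holomorphic_on T" "f ` D \<subseteq> T"
  shows "sep_hol D (\<lambda>p. F (f p))"
proof (rule sep_holI)
  show "continuous_on D (\<lambda>p. F (f p))"
    by (rule continuous_on_compose2[OF holomorphic_on_imp_continuous_on[OF assms(2)]
          sep_hol_imp_continuous_on[OF assms(1)] assms(3)])
next
  fix p :: "'a \<times> 'a" and b :: 'a assume "b \<in> Basis"
  hence "(\<lambda>\<zeta>. f (p + cdir b \<zeta>)) holomorphic_on (\<lambda>\<zeta>. p + cdir b \<zeta>) -` D"
    using assms by (intro sep_hol_slice)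
  from holomorphic_on_compose_gen[OF this assms(2)] assms(3)
  show "(\<lambda>\<zeta>. F (f (p + cdir b \<zeta>))) holomorphic_on (\<lambda>\<zeta>. p + cdir b \<zeta>) -` D"
    by (auto simp: o_def)
qed

text \<open>The function is the complexification of \<open>L\<close>; along a coordinate direction
  \<open>b\<close> it is affine in the complex variable, with slope \<open>L b\<close>. It supplies
  the complex versions of the parameters.\<close>

lemma sep_hol_linear:
  assumes "bounded_linear (L :: 'a::euclidean_space \<Rightarrow> real)"
  shows "sep_hol D (\<lambda>p. Complex (L (fst p)) (L (snd p)))"
proof (rule sep_holI)
  interpret L: bounded_linear L by fact
  have c: "continuous_on UNIV L" by (rule L.continuous_on) auto
  show "continuous_on D (\<lambda>p. Complex (L (fst p)) (L (snd p)))"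
    unfolding Complex_eq
    by (intro continuous_intros continuous_on_compose2[OF c]) auto
  fix p :: "'a \<times> 'a" and b :: 'a
  have "(\<lambda>\<zeta>. Complex (L (fst (p + cdir b \<zeta>))) (L (snd (p + cdir b \<zeta>)))) =
      (\<lambda>\<zeta>. Complex (L (fst p)) (L (snd p)) + of_real (L b) * \<zeta>)"
    by (auto simp: fun_eq_iff complex_eq_iff cdir_def L.add L.scaleR)
  moreover have "(\<lambda>\<zeta>. Complex (L (fst p)) (L (snd p)) + of_real (L b) * \<zeta>) holomorphic_on
     (\<lambda>\<zeta>. p + cdir b \<zeta>) -` D"
    by (intro holomorphic_intros)
  ultimately show "(\<lambda>\<zeta>. Complex (L (fst (p + cdir b \<zeta>))) (L (snd (p + cdir b \<zeta>)))) holomorphic_on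
     (\<lambda>\<zeta>. p + cdir b \<zeta>) -` D"
    by (simp only:)
qed

lemma sep_hol_uniform_limit:
  assumes "open D" "uniform_limit D f g sequentially" and f: "\<And>n::nat. sep_hol D (f n)"
  shows "sep_hol D g"
proof (rule sep_holI)
  show "continuous_on D g"
    by (rule uniform_limit_theorem[OF always_eventually assms(2)])
       (use f in \<open>auto intro: sep_hol_imp_continuous_on\<close>)
next
  fix p :: "'a \<times> 'a" and b :: 'a assume b: "b \<in> Basis"
  let ?S = "(\<lambda>\<zeta>. p + cdir b \<zeta>) -` D"
  have ul: "uniform_limit ?S (\<lambda>n \<zeta>. f n (p + cdir b \<zeta>)) (\<lambda>\<zeta>. g (p + cdir b \<zeta>)) sequentially"
    using assms(2) by (rule uniform_limit_compose') auto
  show "(\<lambda>\<zeta>. g (p + cdir b \<zeta>)) holomorphic_on ?S"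
  proof (rule holomorphic_uniform_sequence)
    show "open ?S" by (rule open_slice) fact
    show "(\<lambda>\<zeta>. f n (p + cdir b \<zeta>)) holomorphic_on ?S" for n
      by (rule sep_hol_slice[OF f b])
    show "\<exists>d>0. cball z d \<subseteq> ?S \<and> uniform_limit (cball z d) (\<lambda>n \<zeta>. f n (p + cdir b \<zeta>)) 
       (\<lambda>\<zeta>. g (p + cdir b \<zeta>)) sequentially" if "z \<in> ?S" for z
      using that \<open>open ?S\<close> ul by (meson open_contains_cball uniform_limit_on_subset)
  qed
qed

definition cpartial :: "'a::euclidean_space \<Rightarrow> ('a \<times> 'a \<Rightarrow> complex) \<Rightarrow> 'a \<times> 'a \<Rightarrow> complex" where
  "cpartial b f p = deriv (\<lambda>\<zeta>. f (p + cdir b \<zeta>)) 0"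

text \<open>By the Cauchy estimates for the second derivative, the difference quotients converge
  locally uniformly to the partial derivative.\<close>

lemma sep_hol_cpartial:
  assumes "open D" "sep_hol D f" and b: "b \<in> Basis"
  shows "sep_hol D (cpartial b f)"
proof (rule sep_hol_local)
  fix p0 assume "p0 \<in> D"
  then obtain e where e: "e > 0" "cball p0 e \<subseteq> D"
    using assms(1) open_contains_cball by blast
  \<comment> \<open>Half the radius: a point of \<open>ball p0 R\<close> shifted by less than
    \<open>R\<close> stays in \<open>cball p0 e\<close>, where \<open>f\<close> is bounded.\<close>
  define R where "R = e / 2"
  have R: "R > 0" using e by (simp add: R_def)
  have cont: "continuous_on (cball p0 e) f"
    using sep_hol_imp_continuous_on[OF assms(2)] e continuous_on_subset by blast
  have "bounded (f ` cball p0 e)"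
    by (intro compact_imp_bounded compact_continuous_image cont) auto
  then obtain B where B: "\<And>p. p \<in> cball p0 e \<Longrightarrow> norm (f p) \<le> B" "B > 0"
    unfolding bounded_pos by blast
  have in_cball: "p + cdir b z \<in> cball p0 e" if "p \<in> ball p0 R" "norm z < R" for p z
  proof -
    have "dist p0 (p + cdir b z) \<le> dist p0 p + norm (cdir b z)"
      by (metis add_diff_cancel_left' dist_norm dist_triangle norm_minus_commute)
    thus ?thesis using that b by (simp add: R_def)
  qed
  define q where "q = (\<lambda>n::nat. \<lambda>p. (f (p + cdir b (of_real (inverse (Suc n)))) - f p) / of_real (inverse (Suc n)))"
  obtain N where N: "inverse (real (Suc N)) < R / 2"
    using reals_Archimedean[of "R/2"] R by auto
  have small: "inverse (real (Suc n)) < R / 2" if "n \<ge> N" for n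
  proof -
    have "inverse (real (Suc n)) \<le> inverse (real (Suc N))"
      using that by (intro le_imp_inverse_le) auto
    thus ?thesis using N by linarith
  qed
  have est: "norm (q n p - cpartial b f p) \<le> 32 * (B+1) / R\<^sup>2 * inverse (Suc n)"
    if p: "p \<in> ball p0 R" and n: "n \<ge> N" for p n
  proof -
    let ?g = "\<lambda>\<zeta>. f (p + cdir b \<zeta>)" and ?h = "of_real (inverse (Suc n)) :: complex"
    have nh: "norm ?h = inverse (Suc n)" by (simp only: norm_of_real) simp
    have "norm (?g ?h - ?g 0 - deriv ?g 0 * ?h) \<le> 32 * (B+1) / R\<^sup>2 * (norm ?h)\<^sup>2"
    proof (rule holomorphic_linear_approx[OF _ R])
      have "?g holomorphic_on (\<lambda>\<zeta>. p + cdir b \<zeta>) -` D"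
        by (rule sep_hol_slice[OF assms(2) b])
      thus "?g holomorphic_on ball 0 R"
        by (rule holomorphic_on_subset) (use in_cball[OF p] e(2) in fastforce)
      show "norm (f (p + cdir b z)) < B + 1" if "z \<in> ball 0 R" for z
        using B(1)[OF in_cball[OF p, of z]] that by auto
      show "norm ?h < R / 2" using small[OF n] nh by simp
    qed
    moreover have "?g ?h - ?g 0 - deriv ?g 0 * ?h = ?h * (q n p - cpartial b f p)"
      by (simp add: q_def cpartial_def field_simps del: of_nat_Suc)
    ultimately have "norm ?h * norm (q n p - cpartial b f p) \<le> norm ?h * (32 * (B+1) / R\<^sup>2 * norm ?h)"
      by (simp only: norm_mult) (simp add: power2_eq_square mult_ac)
    moreover have "norm ?h > 0" unfolding nh by simp
    ultimately have "norm (q n p - cpartial b f p) \<le> 32 * (B+1) / R\<^sup>2 * norm ?h"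
      by (simp only: mult_le_cancel_left_pos)
    thus ?thesis by (simp only: nh)
  qed
  have "sep_hol (ball p0 R) (cpartial b f)"
  proof (rule sep_hol_uniform_limit[where f = "\<lambda>n. q (n + N)"])
    show "sep_hol (ball p0 R) (q (n + N))" for n
    proof -
      let ?h = "of_real (inverse (Suc (n+N))) :: complex"
      have nh: "norm ?h < R" 
        using small[of "n+N"] R by (simp only: norm_of_real) simp
      have "sep_hol (ball p0 R) (\<lambda>p. f (p + cdir b ?h))"
      proof (rule sep_holI)
        show "continuous_on (ball p0 R) (\<lambda>p. f (p + cdir b ?h))"
          by (rule continuous_on_compose2[OF cont]) (use in_cball nh in \<open>auto intro!: continuous_intros\<close>)
        fix p :: "'a \<times> 'a" and b' :: 'a assume b': "b' \<in> Basis"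
        have "(\<lambda>\<zeta>. f ((p + cdir b ?h) + cdir b' \<zeta>)) holomorphic_on (\<lambda>\<zeta>. (p + cdir b ?h) + cdir b' \<zeta>) -` D"
          by (rule sep_hol_slice[OF assms(2) b'])
        hence "(\<lambda>\<zeta>. f ((p + cdir b ?h) + cdir b' \<zeta>)) holomorphic_on (\<lambda>\<zeta>. p + cdir b' \<zeta>) -` ball p0 R"
        proof (rule holomorphic_on_subset, intro subsetI)
          fix z assume "z \<in> (\<lambda>\<zeta>. p + cdir b' \<zeta>) -` ball p0 R"
          hence "(p + cdir b' z) + cdir b ?h \<in> D"
            using in_cball[OF _ nh] e(2) by blast
          thus "z \<in> (\<lambda>\<zeta>. (p + cdir b ?h) + cdir b' \<zeta>) -` D"
            by (simp add: add_ac)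
        qed
        thus "(\<lambda>\<zeta>. f (p + cdir b' \<zeta> + cdir b ?h)) holomorphic_on (\<lambda>\<zeta>. p + cdir b' \<zeta>) -` ball p0 R"
          by (simp add: algebra_simps)
      qed
      moreover have "sep_hol (ball p0 R) f"
        by (rule sep_hol_subset[OF assms(2)]) (use e R_def in auto)
      ultimately show ?thesis
        unfolding q_def by (intro sep_hol_divide sep_hol_diff sep_hol_const) (auto simp del: of_nat_Suc)
    qed
    show "uniform_limit (ball p0 R) (\<lambda>n. q (n + N)) (cpartial b f) sequentially"
    proof (rule uniform_limitI)
      fix d :: real assume "d > 0"
      have "(\<lambda>n. 32 * (B+1) / R\<^sup>2 * inverse (Suc (n+N))) \<longlonglongrightarrow> 32 * (B+1) / R\<^sup>2 * 0"
        by (intro tendsto_intros LIMSEQ_ignore_initial_segment[OF LIMSEQ_inverse_real_of_nat])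
      hence "\<forall>\<^sub>F n in sequentially. 32 * (B+1) / R\<^sup>2 * inverse (Suc (n+N)) < d"
        using \<open>d > 0\<close> by (intro order_tendstoD) auto
      thus "\<forall>\<^sub>F n in sequentially. \<forall>p\<in>ball p0 R. dist (q (n + N) p) (cpartial b f p) < d"
      proof eventually_elim
        case (elim n)
        thus ?case using est[of _ "n+N"] by (force simp: dist_norm)
      qed
    qed
  qed auto
  thus "\<exists>E. open E \<and> p0 \<in> E \<and> sep_hol E (cpartial b f)"
    using R by (intro exI[of _ "ball p0 R"]) auto
qed

section \<open>Real smoothness from separate holomorphy\<close>

lemma sep_hol_partial_real:
  assumes "open D" "sep_hol D f" "b \<in> Basis" "(x, 0) \<in> D"
  shows "((\<lambda>t. Re (f (x + t *\<^sub>R b, 0))) has_real_derivative Re (cpartial b f (x, 0))) (at 0)"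
proof -
  let ?g = "\<lambda>\<zeta>. f ((x,0) + cdir b \<zeta>)"
  have "?g holomorphic_on (\<lambda>\<zeta>. (x,0) + cdir b \<zeta>) -` D"
    by (rule sep_hol_slice[OF assms(2,3)])
  hence "(?g has_field_derivative cpartial b f (x,0)) (at (of_real 0))"
    unfolding cpartial_def of_real_0
    by (rule holomorphic_derivI[OF _ open_slice[OF assms(1)]]) (use assms(4) in auto)
  hence "((\<lambda>t. ?g (of_real t)) has_vector_derivative cpartial b f (x,0)) (at 0)"
    by (rule has_vector_derivative_real_field)
  hence "((\<lambda>t. Re (?g (of_real t))) has_real_derivative Re (cpartial b f (x,0))) (at 0)"
    by (rule has_field_derivative_Re)
  thus ?thesis
    by (simp add: cdir_def)
qed

text \<open>The increment is telescoped along the coordinate directions; on each leg the mean value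
  inequality is applied to \<open>F\<close> minus its linear part, whose derivative is small by
  continuity of the partials.\<close>

lemma has_derivative_continuous_partials:
  fixes F :: "'a::euclidean_space \<Rightarrow> real"
  assumes "open N" "x \<in> N"
    and deriv: "\<And>y b. y \<in> N \<Longrightarrow> b \<in> Basis \<Longrightarrow> ((\<lambda>t. F (y + t *\<^sub>R b)) has_real_derivative G b y) (at 0)"
    and cont: "\<And>b. b \<in> Basis \<Longrightarrow> continuous_on N (G b)"
  shows "(F has_derivative (\<lambda>v. \<Sum>b\<in>Basis. (v \<bullet> b) * G b x)) (at x)"
  unfolding has_derivative_at_alt
proof safe
  show "bounded_linear (\<lambda>v. \<Sum>b\<in>Basis. (v \<bullet> b) * G b x)"
    by (intro bounded_linear_sum bounded_linear_mult_const bounded_linear_inner_left)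
next
  fix e :: real assume "e > 0"
  \<comment> \<open>There are \<open>c\<close> legs, so each may contribute an error
    \<open>e / c * norm v\<close>. A leg has length at most \<open>norm v\<close>, hence
    \<open>norm v < d / c\<close> keeps the whole path within distance \<open>d\<close> of
    \<open>x\<close>.\<close>
  define c where "c = real DIM('a)"
  have c: "c > 0" by (simp add: c_def)
  have "\<forall>\<^sub>F y in at x. \<forall>b\<in>Basis. norm (G b y - G b x) < e / c"
  proof (intro eventually_ball_finite ballI finite_Basis)
    fix b :: 'a assume "b \<in> Basis"
    hence "(G b \<longlongrightarrow> G b x) (at x)"
      using cont assms(1,2) continuous_on_eq_continuous_at continuous_within by blast
    hence "\<forall>\<^sub>F y in at x. dist (G b y) (G b x) < e / c"
      by (rule tendstoD) (use \<open>e > 0\<close> c in auto)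
    thus "\<forall>\<^sub>F y in at x. norm (G b y - G b x) < e / c"
      by (simp add: dist_norm)
  qed
  moreover have "\<forall>\<^sub>F y in at x. y \<in> N"
    using assms(1,2) by (simp add: eventually_at_in_open')
  ultimately have "\<forall>\<^sub>F y in at x. y \<in> N \<and> (\<forall>b\<in>Basis. norm (G b y - G b x) < e / c)"
    by eventually_elim auto
  then obtain d where "d > 0"
     and d0: "\<And>y. y \<noteq> x \<Longrightarrow> dist y x < d \<Longrightarrow> y \<in> N \<and> (\<forall>b\<in>Basis. norm (G b y - G b x) < e / c)"
    unfolding eventually_at by blast
  have d: "y \<in> N \<and> (\<forall>b\<in>Basis. norm (G b y - G b x) \<le> e / c)" if "dist y x < d" for y
    using d0[of y] that assms(2) \<open>e > 0\<close> c by (cases "y = x") force+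
  have "norm (F y - F x - (\<Sum>b\<in>Basis. ((y-x) \<bullet> b) * G b x)) \<le> e * norm (y - x)"
    if y: "norm (y - x) < d / c" for y
  proof -
    define v where "v = y - x"
    define P where "P = (\<lambda>A. \<Sum>b\<in>A. (v \<bullet> b) *\<^sub>R b)"
    have vb: "\<bar>v \<bullet> b\<bar> \<le> norm v" if "b \<in> Basis" for b using that Basis_le_norm by blast
    have "norm (F (x + P A) - F x - (\<Sum>b\<in>A. (v \<bullet> b) * G b x)) \<le> real (card A) * (e / c) * norm v"
      if "A \<subseteq> Basis" for A
      using finite_subset[OF that finite_Basis] that
    proof (induction A rule: finite_induct)
      case empty
      thus ?case by (simp add: P_def)
    next
      case (insert b A)
      hence b: "b \<in> Basis" and A: "A \<subseteq> Basis" by auto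
      let ?z = "x + P A"
      let ?k = "\<lambda>t. F (?z + t *\<^sub>R b) - t * G b x"
      let ?I = "closed_segment 0 (v \<bullet> b)"
      have in_d: "dist (?z + t *\<^sub>R b) x < d" if "t \<in> ?I" for t
      proof -
        have t: "\<bar>t\<bar> \<le> norm v"
          using that vb[OF b] by (auto simp: closed_segment_eq_real_ivl split: if_splits)
        have "norm (P A + t *\<^sub>R b) \<le> norm (P A) + \<bar>t\<bar>"
          using norm_triangle_ineq[of "P A" "t *\<^sub>R b"] b by simp
        also have "norm (P A) \<le> (\<Sum>b\<in>A. norm v)"
          unfolding P_def using A vb by (intro sum_norm_le) auto
        also have "(\<Sum>b\<in>A. norm v) + \<bar>t\<bar> \<le> (\<Sum>b\<in>insert b A. norm v)"
          using insert.hyps t by (simp add: algebra_simps)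
        also have "\<dots> \<le> (\<Sum>b\<in>(Basis::'a set). norm v)"
          by (rule sum_mono2) (use insert.prems in auto)
        also have "\<dots> = c * norm v" by (simp add: c_def)
        also have "\<dots> < d" using y c by (simp add: v_def field_simps)
        finally show ?thesis by (simp add: dist_norm add.assoc)
      qed
      have "norm (?k (v \<bullet> b) - ?k 0) \<le> e / c * norm (v \<bullet> b - 0)"
      proof (rule field_differentiable_bound)
        fix t assume t: "t \<in> ?I"
        have "((\<lambda>u. F ((?z + t *\<^sub>R b) + u *\<^sub>R b)) has_real_derivative G b (?z + t *\<^sub>R b)) (at 0)"
          using deriv[OF _ b] d[OF in_d[OF t]] by blast
        hence "((\<lambda>u. F ((?z + t *\<^sub>R b) + (u - t) *\<^sub>R b)) has_real_derivative G b (?z + t *\<^sub>R b) * 1) (at t)"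
          by (intro DERIV_chain'[where f = "\<lambda>u. u - t" and g = "\<lambda>u. F ((?z + t *\<^sub>R b) + u *\<^sub>R b)"])
             (auto intro!: derivative_eq_intros)
        moreover have "(\<lambda>u. F ((?z + t *\<^sub>R b) + (u - t) *\<^sub>R b)) = (\<lambda>u. F (?z + u *\<^sub>R b))"
          by (simp add: algebra_simps)
        ultimately have "((\<lambda>u. F (?z + u *\<^sub>R b)) has_real_derivative G b (?z + t *\<^sub>R b)) (at t)"
          by (metis mult_1_right)
        from has_field_derivative_at_within[OF DERIV_diff[OF this DERIV_cmult_right[OF DERIV_ident]]]
        show "(?k has_field_derivative G b (?z + t *\<^sub>R b) - G b x) (at t within ?I)"
          by simp
        show "norm (G b (?z + t *\<^sub>R b) - G b x) \<le> e / c"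
          using d[OF in_d[OF t]] b by blast
      qed auto
      also have "\<dots> \<le> e / c * norm v"
        using vb[OF b] \<open>e > 0\<close> c by (intro mult_left_mono) auto
      finally have 1: "norm (?k (v \<bullet> b) - ?k 0) \<le> e / c * norm v" .
      have 2: "norm (F (x + P A) - F x - (\<Sum>b\<in>A. (v \<bullet> b) * G b x)) \<le> real (card A) * (e / c) * norm v"
        using insert.IH A by blast
      have P: "x + P (insert b A) = ?z + (v \<bullet> b) *\<^sub>R b"
        using insert.hyps by (simp add: P_def)
      have "F (x + P (insert b A)) - F x - (\<Sum>b\<in>insert b A. (v \<bullet> b) * G b x)
          = (?k (v \<bullet> b) - ?k 0) + (F (x + P A) - F x - (\<Sum>b\<in>A. (v \<bullet> b) * G b x))"
        unfolding P using insert.hyps by simp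
      also have "norm \<dots> \<le> e / c * norm v + real (card A) * (e / c) * norm v"
        by (rule norm_triangle_mono[OF 1 2])
      also have "\<dots> = real (card (insert b A)) * (e / c) * norm v"
        using insert.hyps by (simp add: algebra_simps)
      finally show ?case .
    qed
    from this[OF subset_refl] show ?thesis
      using c by (simp add: P_def euclidean_representation c_def[symmetric]) (simp add: v_def)
  qed
  thus "\<exists>d>0. \<forall>y. norm (y - x) < d \<longrightarrow>
           norm (F y - F x - (\<Sum>b\<in>Basis. (y - x) \<bullet> b * G b x)) \<le> e * norm (y - x)"
    using \<open>d > 0\<close> c by (intro exI[of _ "d / c"]) auto
qed

text \<open>Induction on \<open>k\<close> with \<open>f\<close> arbitrary: at real points the real
  partial derivatives of the real part are real parts of \<open>cpartial b f\<close>, which is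
  separately holomorphic again.\<close>

lemma sep_hol_imp_Ck:
  assumes "open D" "sep_hol D f" "open N" "\<And>x. x \<in> N \<Longrightarrow> (x, 0) \<in> D"
  shows "Ck k (\<lambda>x. Re (f (x, 0))) N"
  using assms(2)
proof (induction k arbitrary: f)
  case (0 f)
  have "continuous_on N (\<lambda>x. f (x, 0))"
    by (rule continuous_on_compose2[of D f])
       (use 0 assms(4) in \<open>auto simp: sep_hol_def intro!: continuous_intros\<close>)
  thus ?case by (auto intro!: continuous_intros)
next
  case (Suc k f)
  let ?G = "\<lambda>b x. Re (cpartial b f (x, 0))"
  have sep: "sep_hol D (cpartial b f)" if "b \<in> Basis" for b
    by (rule sep_hol_cpartial[OF assms(1) Suc.prems that])
  have *: "((\<lambda>x. Re (f (x, 0))) has_derivative (\<lambda>v. \<Sum>b\<in>Basis. (v \<bullet> b) * ?G b x)) (at x)"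
    if "x \<in> N" for x
  proof (rule has_derivative_continuous_partials[OF assms(3) that])
    show "continuous_on N (?G b)" if "b \<in> Basis" for b
    proof -
      have "continuous_on N (\<lambda>x. cpartial b f (x, 0))"
        by (rule continuous_on_compose2[of D "cpartial b f"])
           (use sep[OF that] assms(4) in \<open>auto simp: sep_hol_def intro!: continuous_intros\<close>)
      thus ?thesis by (auto intro!: continuous_intros)
    qed
  qed (use sep_hol_partial_real[OF assms(1) Suc.prems] assms(4) in blast)
  have "Ck k (\<lambda>x. \<Sum>b\<in>Basis. (i \<bullet> b) * ?G b x) N" if "i \<in> Basis" for i
  proof -
    have "(\<lambda>x. \<Sum>b\<in>Basis. (i \<bullet> b) * ?G b x) = ?G i"
    proof
      fix x
      have "(\<Sum>b\<in>Basis. (i \<bullet> b) * ?G b x) = (\<Sum>b\<in>Basis. if b = i then ?G b x else 0)"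
        using that by (intro sum.cong) (auto simp: inner_Basis)
      thus "(\<Sum>b\<in>Basis. (i \<bullet> b) * ?G b x) = ?G i x" using that by simp
    qed
    thus ?thesis using Suc.IH[OF sep[OF that]] by simp
  qed
  with * show ?case by (auto intro!: exI[of _ "\<lambda>x v. \<Sum>b\<in>Basis. (v \<bullet> b) * ?G b x"])
qed

section \<open>Frobenius coefficients\<close>

text \<open>With \<open>c\<^sub>1 = a\<^sup>2 - 1\<close>, the numbers \<open>frob_rhs a c2 c3 j\<close> for \<open>j \<ge> 1\<close> are the Taylor coefficients
  of \<open>P\<^sub>c / (2 (2 - t)\<^sup>2)\<close> in \<open>t = 1 + x\<close>.\<close>

definition frob_rhs :: "'a::real_normed_field \<Rightarrow> 'a \<Rightarrow> 'a \<Rightarrow> nat \<Rightarrow> 'a" where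
  "frob_rhs a c2 c3 j = (a\<^sup>2 - 1 + c2 * of_nat j + 2 * c3) / 2 ^ (j + 2)"

text \<open>Coefficients of h in phi = t^s h(t) with s = (1+a)/2. The denominator is the indicial
  factor (s+n)(s+n-1) - s(s-1) = n (n + a). Stated over a general field, so that one recursion gives
  both the real coefficients and their complex extension.\<close>

fun frob :: "'a::real_normed_field \<Rightarrow> 'a \<Rightarrow> 'a \<Rightarrow> nat \<Rightarrow> 'a" where
  "frob a c2 c3 n = (if n = 0 then 1 else
     (\<Sum>k<n. frob_rhs a c2 c3 (n - k) * frob a c2 c3 k) / (of_nat n * (of_nat n + a)))"

declare frob.simps [simp del]

lemma frob_0 [simp]: "frob a c2 c3 0 = 1"
  by (simp add: frob.simps)

lemma frob_rec:
  "n > 0 \<Longrightarrow> frob a c2 c3 n =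
     (\<Sum>k<n. frob_rhs a c2 c3 (n - k) * frob a c2 c3 k) / (of_nat n * (of_nat n + a))"
  by (subst frob.simps) simp

lemma frob_of_real:
  "frob (of_real a) (of_real c2) (of_real c3) n = of_real (frob a c2 c3 n)"
proof (induction n rule: less_induct)
  case (less n)
  have "frob_rhs (of_real a) (of_real c2) (of_real c3) j = (of_real (frob_rhs a c2 c3 j) :: 'a)" for j
    by (simp add: frob_rhs_def)
  thus ?case using less by (cases "n = 0") (simp_all add: frob_rec)
qed

section \<open>Growth of the coefficients, uniformly in the parameters\<close>

lemma norm_frob_le_aux:
  fixes a c2 c3 :: "'a::real_normed_field"
  assumes a: "\<And>n. real n \<le> norm (of_nat n + a)"
    and r: "\<And>j. norm (frob_rhs a c2 c3 j) \<le> M * \<rho> ^ j" and "\<rho> > 0"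
  shows "norm (frob a c2 c3 n) \<le> (1 + M) * exp (M * (\<Sum>k. inverse (real k ^ 2))) * \<rho> ^ n"
proof -
  \<comment> \<open>The recursion gives \<open>|a\<^sub>n| \<le> M S\<^sub>n / n\<^sup>2\<close>, hence \<open>S\<^sub>n\<^sub>+\<^sub>1 \<le> \<rho> (1 + M / n\<^sup>2) S\<^sub>n\<close>.\<close>
  define S where "S = (\<lambda>n. \<Sum>k<n. \<rho> ^ (n - k) * norm (frob a c2 c3 k))"
  \<comment> \<open>The summand at \<open>k = 0\<close> is \<open>inverse 0 = 0\<close>, so this is
    the convergent sum over \<open>k >= 1\<close>.\<close>
  define Z where "Z = (\<Sum>k. inverse (real k ^ 2))"
  have M: "M \<ge> 0" using r[of 0] norm_ge_zero[of "frob_rhs a c2 c3 0"] by (simp del: norm_ge_zero)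
  have S_nonneg: "S n \<ge> 0" for n
    unfolding S_def using \<open>\<rho> > 0\<close> by (intro sum_nonneg) auto
  have step: "norm (frob a c2 c3 n) \<le> M * S n / real n ^ 2" if "n > 0" for n
  proof -
    have "norm (frob a c2 c3 n) = norm (\<Sum>k<n. frob_rhs a c2 c3 (n - k) * frob a c2 c3 k) / (real n * norm (of_nat n + a))"
      using that by (simp add: frob_rec norm_divide norm_mult)
    also have "\<dots> \<le> norm (\<Sum>k<n. frob_rhs a c2 c3 (n - k) * frob a c2 c3 k) / (real n * real n)"
      using that a[of n] by (intro divide_left_mono mult_left_mono mult_pos_pos) (auto intro: less_le_trans[of 0 "real n"])
    also have "norm (\<Sum>k<n. frob_rhs a c2 c3 (n - k) * frob a c2 c3 k) \<le> (\<Sum>k<n. (M * \<rho> ^ (n - k)) * norm (frob a c2 c3 k))"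
      by (intro sum_norm_le) (auto simp: norm_mult intro!: mult_right_mono r)
    also have "\<dots> = M * S n" by (simp add: S_def sum_distrib_left mult_ac)
    finally show ?thesis using that by (simp add: power2_eq_square divide_right_mono)
  qed
  have S_Suc: "S (Suc n) = \<rho> * (S n + norm (frob a c2 c3 n))" for n
  proof -
    have "S (Suc n) = (\<Sum>k<n. \<rho> ^ Suc (n - k) * norm (frob a c2 c3 k)) + \<rho> * norm (frob a c2 c3 n)"
      unfolding S_def by (simp add: Suc_diff_le del: power_Suc)
    thus ?thesis by (simp add: S_def sum_distrib_left distrib_left mult_ac)
  qed
  have S_le: "S n \<le> \<rho> ^ n * exp (M * (\<Sum>k<n. inverse (real k ^ 2)))" for n
  proof (induction n)
    case 0
    thus ?case by (simp add: S_def)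
  next
    case (Suc n)
    show ?case
    proof (cases "n = 0")
      case True
      thus ?thesis by (simp add: S_def)
    next
      case False
      have "S (Suc n) \<le> \<rho> * (S n + M * S n / real n ^ 2)"
        unfolding S_Suc using step[of n] False \<open>\<rho> > 0\<close> by (intro mult_left_mono) auto
      also have "\<dots> = \<rho> * (S n * (1 + M * inverse (real n ^ 2)))"
        by (simp add: field_simps)
      \<comment> \<open>\<open>1 + y <= exp y\<close> turns the product of the factors
        \<open>1 + M / k^2\<close> into the exponential of a convergent sum.\<close>
      also have "\<dots> \<le> \<rho> * ((\<rho> ^ n * exp (M * (\<Sum>k<n. inverse (real k ^ 2)))) * exp (M * inverse (real n ^ 2)))"
        using \<open>\<rho> > 0\<close> M Suc.IH S_nonneg[of n]
        by (intro mult_left_mono mult_mono exp_ge_add_one_self) auto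
      finally show ?thesis by (simp add: exp_add distrib_left mult_ac)
    qed
  qed
  have Z: "(\<Sum>k<n. inverse (real k ^ 2)) \<le> Z" for n
    unfolding Z_def by (intro sum_le_suminf inverse_power_summable) auto
  have eZ: "exp (M * Z) \<ge> 1"
    using Z[of 0] M by simp
  show ?thesis
  proof (cases "n = 0")
    case True
    thus ?thesis using eZ M mult_mono[of 1 "1 + M" 1 "exp (M * Z)"] by (simp add: Z_def)
  next
    case False
    have "norm (frob a c2 c3 n) \<le> M * S n / real n ^ 2" using step False by simp
    also have "\<dots> \<le> M * S n / 1"
      using False M S_nonneg by (intro divide_left_mono) auto
    also have "\<dots> \<le> (1 + M) * (\<rho> ^ n * exp (M * Z))"
    proof -
      have "S n \<le> \<rho> ^ n * exp (M * Z)"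
        using S_le[of n] Z[of n] M \<open>\<rho> > 0\<close>
        by (elim order_trans) (auto intro!: mult_left_mono)
      thus ?thesis using M S_nonneg[of n] by (simp del: exp_le_cancel_iff) (intro mult_mono; simp)
    qed
    finally show ?thesis by (simp add: Z_def mult_ac)
  qed
qed

text \<open>The coefficients \<open>frob_rhs\<close> grow like j / 2^j. Any
  \<open>\<rho> > 1/2\<close> absorbs the factor j, because j (1 / (2 \<rho>))^j is bounded. Letting
  \<open>\<rho>\<close> approach 1/2 gives radius of convergence 2; a fixed
  \<open>\<rho> < 1\<close> gives uniform convergence at t = 1.\<close>

lemma norm_frob_le:
  assumes "\<rho> > 1/2"
  shows "\<exists>C. \<forall>a c2 c3 :: 'a::real_normed_field. norm a \<le> K \<longrightarrow> norm c2 \<le> K \<longrightarrow> norm c3 \<le> K \<longrightarrow>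
    (\<forall>n. real n \<le> norm (of_nat n + a)) \<longrightarrow> (\<forall>n. norm (frob a c2 c3 n) \<le> C * \<rho> ^ n)"
proof -
  define x where "x = 1 / (2 * \<rho>)"
  have x: "0 < x" "x < 1" using assms by (auto simp: x_def field_simps)
  have "(\<lambda>n. of_nat n * x ^ n) \<longlonglongrightarrow> 0" by (rule powser_times_n_limit_0) (use x in auto)
  hence "Bseq (\<lambda>n. real n * x ^ n)" by (rule convergent_imp_Bseq[OF convergentI])
  then obtain B where B: "\<And>n. norm (real n * x ^ n) \<le> B" unfolding Bseq_def by blast
  define M where "M = (K\<^sup>2 + 1 + 2 * K) + K * B"
  have "norm (frob a c2 c3 n) \<le> (1 + M) * exp (M * (\<Sum>k. inverse (real k ^ 2))) * \<rho> ^ n"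
    if K: "norm a \<le> K" "norm c2 \<le> K" "norm c3 \<le> K" and a: "\<And>n. real n \<le> norm (of_nat n + a)"
    for a c2 c3 :: 'a and n
  proof (rule norm_frob_le_aux[OF a])
    have "K \<ge> 0" using K(1) norm_ge_zero order_trans by blast
    fix j
    have x_pow: "(1/2) ^ j = x ^ j * \<rho> ^ j" using assms by (simp add: x_def flip: power_mult_distrib)
    have "norm (a\<^sup>2 - 1 + c2 * of_nat j + 2 * c3) \<le> norm (a\<^sup>2) + norm (1::'a) + norm (c2 * of_nat j) + norm (2 * c3)"
      by (intro norm_triangle_mono norm_triangle_ineq4) auto
    also have "\<dots> \<le> K\<^sup>2 + 1 + K * real j + 2 * K"
      using K by (auto simp: norm_power norm_mult intro!: add_mono power_mono mult_right_mono)
    finally have "norm (frob_rhs a c2 c3 j) \<le> (K\<^sup>2 + 1 + K * real j + 2 * K) / 2 ^ (j + 2)"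
      by (simp add: frob_rhs_def norm_divide norm_power divide_right_mono)
    also have "\<dots> \<le> (K\<^sup>2 + 1 + K * real j + 2 * K) / 2 ^ j"
      using \<open>K \<ge> 0\<close> by (intro divide_left_mono) auto
    also have "\<dots> = ((K\<^sup>2 + 1 + 2 * K) * x ^ j + K * (real j * x ^ j)) * \<rho> ^ j"
      using x_pow by (simp add: field_simps power_one_over)
    also have "\<dots> \<le> ((K\<^sup>2 + 1 + 2 * K) * 1 + K * B) * \<rho> ^ j"
      using B[of j] x \<open>K \<ge> 0\<close> assms
      by (intro mult_right_mono add_mono mult_left_mono power_le_one) (auto simp: abs_le_iff)
    finally show "norm (frob_rhs a c2 c3 j) \<le> M * \<rho> ^ j" by (simp add: M_def)
  qed (use assms in auto)
  thus ?thesis by blast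
qed

text \<open>This and \<open>frob_dsum\<close> are h(1) and h'(1), the data at t = 1, that is at x =
  0, where gamma is read off.\<close>

definition frob_sum :: "'a::{real_normed_field,banach} \<Rightarrow> 'a \<Rightarrow> 'a \<Rightarrow> 'a" where
  "frob_sum a c2 c3 = (\<Sum>n. frob a c2 c3 n)"

definition frob_dsum :: "'a::{real_normed_field,banach} \<Rightarrow> 'a \<Rightarrow> 'a \<Rightarrow> 'a" where
  "frob_dsum a c2 c3 = (\<Sum>n. of_nat n * frob a c2 c3 n)"

text \<open>The ratio 3/4 is one choice strictly between 1/2 and 1: it is admissible in
  \<open>norm_frob_le\<close>, and both majorants are summable at t = 1.\<close>

lemma frob_majorant:
  "\<exists>C. (\<forall>a c2 c3 :: 'a::{real_normed_field,banach}. norm a \<le> K \<longrightarrow> norm c2 \<le> K \<longrightarrow> norm c3 \<le> K \<longrightarrow>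
    (\<forall>n. real n \<le> norm (of_nat n + a)) \<longrightarrow> (\<forall>n. norm (frob a c2 c3 n) \<le> C * (3/4) ^ n \<and>
       norm (of_nat n * frob a c2 c3 n) \<le> C * (real n * (3/4) ^ n)))"
proof -
  obtain C where C: "\<forall>a c2 c3 :: 'a. norm a \<le> K \<longrightarrow> norm c2 \<le> K \<longrightarrow> norm c3 \<le> K \<longrightarrow>
    (\<forall>n. real n \<le> norm (of_nat n + a)) \<longrightarrow> (\<forall>n. norm (frob a c2 c3 n) \<le> C * (3/4) ^ n)"
    using norm_frob_le[of "3/4" K] by auto
  thus ?thesis
    by (intro exI[of _ C]) (auto simp: norm_mult mult.left_commute[of C] intro!: mult_left_mono)
qed

lemma summable_majorant:
  "summable (\<lambda>n. C * (3/4 :: real) ^ n)" "summable (\<lambda>n. C * (real n * (3/4) ^ n))"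
proof -
  have "summable (\<lambda>n. real (Suc n) * (3/4) ^ n)" using geometric_deriv_sums[of "3/4::real"] by (auto simp: sums_iff)
  moreover have g: "summable (\<lambda>n. (3/4::real) ^ n)" by (rule summable_geometric) auto
  ultimately have "summable (\<lambda>n. real (Suc n) * (3/4) ^ n - (3/4) ^ n)" by (rule summable_diff)
  hence "summable (\<lambda>n. real n * (3/4) ^ n)" by (simp add: algebra_simps)
  with g show "summable (\<lambda>n. C * (3/4 :: real) ^ n)" "summable (\<lambda>n. C * (real n * (3/4) ^ n))"
    by (auto intro: summable_mult)
qed

text \<open>The form in which nonnegativity of \<open>a\<close>, or of its real part, enters the
  coefficient bounds: it makes sense in every normed field and bounds the denominators below by
  n^2.\<close>

lemma frob_nonneg_shift: "a \<ge> 0 \<Longrightarrow> real n \<le> norm (of_nat n + a)" for a :: real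
  by simp

lemma frob_Re_shift: "Re a \<ge> 0 \<Longrightarrow> real n \<le> norm (of_nat n + a)"
  using complex_Re_le_cmod[of "of_nat n + a"] by simp

lemma summable_frob:
  fixes a c2 c3 :: real assumes "a \<ge> 0"
  shows "summable (frob a c2 c3)" "summable (\<lambda>n. of_nat n * frob a c2 c3 n)"
proof -
  obtain C where C: "\<And>n. norm (frob a c2 c3 n) \<le> C * (3/4) ^ n"
       "\<And>n. norm (of_nat n * frob a c2 c3 n) \<le> C * (real n * (3/4) ^ n)"
    using frob_majorant[of "max (norm a) (max (norm c2) (norm c3))", where ?'a = real]
      frob_nonneg_shift[OF assms]
    by (metis max.cobounded1 max.cobounded2 max.coboundedI2)
  show "summable (frob a c2 c3)" "summable (\<lambda>n. of_nat n * frob a c2 c3 n)"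
    using summable_comparison_test'[OF summable_majorant(1)[of C] C(1)]
      summable_comparison_test'[OF summable_majorant(2)[of C] C(2)] by auto
qed

lemma frob_sum_of_real:
  assumes "a \<ge> 0"
  shows "frob_sum (complex_of_real a) (of_real c2) (of_real c3) = of_real (frob_sum a c2 c3)"
    "frob_dsum (complex_of_real a) (of_real c2) (of_real c3) = of_real (frob_dsum a c2 c3)"
  using suminf_of_real[OF summable_frob(1)[OF assms, of c2 c3], where ?'a = complex]
    suminf_of_real[OF summable_frob(2)[OF assms, of c2 c3], where ?'a = complex]
  by (simp_all add: frob_sum_def frob_dsum_def frob_of_real)

lemma sep_hol_frob:
  assumes "sep_hol D A" "sep_hol D C2" "sep_hol D C3" "\<And>p. p \<in> D \<Longrightarrow> Re (A p) \<ge> 0"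
  shows "sep_hol D (\<lambda>p. frob (A p) (C2 p) (C3 p) n)"
proof (induction n rule: less_induct)
  case (less n)
  have rhs: "sep_hol D (\<lambda>p. frob_rhs (A p) (C2 p) (C3 p) j)" for j
    unfolding frob_rhs_def power2_eq_square
    by (intro sep_hol_divide sep_hol_add sep_hol_mult sep_hol_diff sep_hol_const assms) auto
  show ?case
  proof (cases "n = 0")
    case True
    thus ?thesis by (simp add: sep_hol_const)
  next
    case False
    have "of_nat n * (of_nat n + A p) \<noteq> 0" if "p \<in> D" for p
      using assms(4)[OF that] False frob_Re_shift[of "A p" n] by auto
    hence "sep_hol D (\<lambda>p. (\<Sum>k<n. frob_rhs (A p) (C2 p) (C3 p) (n - k) * frob (A p) (C2 p) (C3 p) k)
             / (of_nat n * (of_nat n + A p)))"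
      by (intro sep_hol_divide sep_hol_sum sep_hol_mult sep_hol_add sep_hol_const rhs less.IH assms(1)) auto
    thus ?thesis using False by (simp add: frob_rec)
  qed
qed

text \<open>The common bound \<open>K\<close> makes the majorants independent of the point, so the
  Weierstrass M-test yields uniform convergence on \<open>D\<close>.\<close>

lemma sep_hol_frob_sums:
  assumes "open D" "sep_hol D A" "sep_hol D C2" "sep_hol D C3" "\<And>p. p \<in> D \<Longrightarrow> Re (A p) \<ge> 0"
    and K: "\<And>p. p \<in> D \<Longrightarrow> norm (A p) \<le> K \<and> norm (C2 p) \<le> K \<and> norm (C3 p) \<le> K"
  shows "sep_hol D (\<lambda>p. frob_sum (A p) (C2 p) (C3 p))" "sep_hol D (\<lambda>p. frob_dsum (A p) (C2 p) (C3 p))"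
proof -
  obtain C where C: "\<And>n p. p \<in> D \<Longrightarrow> norm (frob (A p) (C2 p) (C3 p) n) \<le> C * (3/4) ^ n"
       "\<And>n p. p \<in> D \<Longrightarrow> norm (of_nat n * frob (A p) (C2 p) (C3 p) n) \<le> C * (real n * (3/4) ^ n)"
    using frob_majorant[of K, where ?'a = complex] K frob_Re_shift assms(5) by metis
  note coeff = sep_hol_frob[OF assms(2-5)]
  show "sep_hol D (\<lambda>p. frob_sum (A p) (C2 p) (C3 p))"
    unfolding frob_sum_def
    by (rule sep_hol_uniform_limit[OF assms(1) Weierstrass_m_test[OF C(1) summable_majorant(1)]])
       (auto intro: sep_hol_sum coeff)
  show "sep_hol D (\<lambda>p. frob_dsum (A p) (C2 p) (C3 p))"
    unfolding frob_dsum_def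
    by (rule sep_hol_uniform_limit[OF assms(1) Weierstrass_m_test[OF C(2) summable_majorant(2)]])
       (assumption, intro sep_hol_sum sep_hol_mult sep_hol_const coeff)
qed

section \<open>The Frobenius solution\<close>

definition frob_fps :: "real \<Rightarrow> real \<Rightarrow> real \<Rightarrow> real fps" where
  "frob_fps a c2 c3 = Abs_fps (frob a c2 c3)"

lemma conv_radius_geI_geometric:
  fixes f :: "nat \<Rightarrow> 'a::{banach,real_normed_div_algebra}"
  assumes "R > 0" and "\<And>\<rho>. \<rho> > 1 / R \<Longrightarrow> \<exists>C. \<forall>n. norm (f n) \<le> C * \<rho> ^ n"
  shows "conv_radius f \<ge> ereal R"
proof (rule conv_radius_geI_ex)
  fix r assume r: "0 < r" "ereal r < ereal R"
  \<comment> \<open>Strictly between \<open>1 / R\<close> and \<open>1 / r\<close>: large enough for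
    the hypothesis, small enough that \<open>\<rho> * r < 1\<close>.\<close>
  define \<rho> where "\<rho> = (1 / R + 1 / r) / 2"
  have "1 / R < 1 / r" using r by (simp add: frac_less2)
  hence \<rho>: "\<rho> > 1 / R \<and> \<rho> < 1 / r" unfolding \<rho>_def by argo
  have \<rho>r: "0 < \<rho> * r" "\<rho> * r < 1" using \<rho> r assms(1) less_trans[of 0 "1/R" \<rho>]
    by (auto simp: field_simps)
  obtain C where C: "\<And>n. norm (f n) \<le> C * \<rho> ^ n" using assms(2) \<rho> by blast
  have "summable (\<lambda>n. f n * of_real r ^ n)"
  proof (rule summable_comparison_test')
    show "summable (\<lambda>n. C * (\<rho> * r) ^ n)"
      using \<rho>r by (intro summable_mult summable_geometric) auto
    show "norm (f n * of_real r ^ n) \<le> C * (\<rho> * r) ^ n" for n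
      using C[of n] r mult_right_mono[of "norm (f n)" "C * \<rho> ^ n" "r ^ n"]
      by (simp add: norm_mult norm_power power_mult_distrib)
  qed
  thus "\<exists>z. norm z = r \<and> summable (\<lambda>n. f n * z ^ n)"
    using r by (intro exI[of _ "of_real r"]) auto
qed

lemma conv_radius_frob:
  assumes "a \<ge> 0"
  shows "fps_conv_radius (frob_fps a c2 c3) \<ge> 2"
proof -
  have "conv_radius (frob a c2 c3) \<ge> ereal 2"
  proof (rule conv_radius_geI_geometric)
    fix \<rho> :: real assume "\<rho> > 1 / 2"
    from norm_frob_le[OF this, of "max (norm a) (max (norm c2) (norm c3))", where ?'a = real]
    show "\<exists>C. \<forall>n. norm (frob a c2 c3 n) \<le> C * \<rho> ^ n"
      using frob_nonneg_shift[OF assms] by (metis max.cobounded1 max.cobounded2 max.coboundedI2)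
  qed auto
  thus ?thesis by (simp add: fps_conv_radius_def frob_fps_def)
qed

text \<open>The constant term is 0 because the Taylor coefficient at order 0, (a^2 - 1)/4 = s(s-1),
  is absorbed by the prefactor t^s; the value \<open>frob_rhs a c2 c3 0\<close> is not that
  coefficient.\<close>

definition frob_rhs_fps :: "real \<Rightarrow> real \<Rightarrow> real \<Rightarrow> real fps" where
  "frob_rhs_fps a c2 c3 = Abs_fps (\<lambda>j. if j = 0 then 0 else frob_rhs a c2 c3 j)"

text \<open>The rational function is P_c / (2 (2-t)^2) - (a^2 - 1)/4, the potential without its
  indicial part. In u = t/2 it is a combination of the geometric series and its derivative.\<close>

lemma frob_rhs_sums:
  fixes a c2 c3 t :: real
  assumes "\<bar>t\<bar> < 2"
  shows "(\<lambda>j. fps_nth (frob_rhs_fps a c2 c3) j * t ^ j) sums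
           (t * ((a\<^sup>2 - 1 + 2 * c3) * (2 - t) + 2 * c2) / (4 * (2 - t)\<^sup>2))"
proof -
  define u where "u = t / 2"
  have u: "norm u < 1" "t = 2 * u" "1 - u \<noteq> 0" using assms by (auto simp: u_def)
  let ?k = "(a\<^sup>2 - 1 + 2 * c3) / 4"
  have "(\<lambda>j. ?k * u ^ j + c2 / 4 * (of_nat (Suc j) * u ^ j - u ^ j)) sums
      (?k * (1 / (1 - u)) + c2 / 4 * (1 / (1 - u)\<^sup>2 - 1 / (1 - u)))"
    using u by (intro sums_add sums_mult sums_diff geometric_deriv_sums geometric_sums)
  also have "(\<lambda>j. ?k * u ^ j + c2 / 4 * (of_nat (Suc j) * u ^ j - u ^ j)) = (\<lambda>j. frob_rhs a c2 c3 j * t ^ j)"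
    by (auto simp: fun_eq_iff frob_rhs_def u_def power_divide field_simps)
  finally have s: "(\<lambda>j. frob_rhs a c2 c3 j * t ^ j) sums (?k * (1 / (1 - u)) + c2 / 4 * (1 / (1 - u)\<^sup>2 - 1 / (1 - u)))" .
  have "(\<lambda>j. if j = 0 then frob_rhs a c2 c3 0 * t ^ 0 else 0) sums (frob_rhs a c2 c3 0 * t ^ 0)"
    using sums_single[of 0 "\<lambda>j. frob_rhs a c2 c3 j * t ^ j"] by (simp add: if_distrib cong: if_cong)
  from sums_diff[OF s this]
  have "(\<lambda>j. fps_nth (frob_rhs_fps a c2 c3) j * t ^ j) sums
     (?k * (1 / (1 - u)) + c2 / 4 * (1 / (1 - u)\<^sup>2 - 1 / (1 - u)) - ?k)"
    by (rule sums_cong[THEN iffD1, rotated, of _ _ _, THEN iffD1[OF arg_cong[of _ _ "\<lambda>z. _ sums z"], rotated]])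
       (auto simp: frob_rhs_fps_def frob_rhs_def)
  moreover have "?k * (1 / (1 - u)) + c2 / 4 * (1 / (1 - u)\<^sup>2 - 1 / (1 - u)) - ?k =
      t * ((a\<^sup>2 - 1 + 2 * c3) * (2 - t) + 2 * c2) / (4 * (2 - t)\<^sup>2)"
  proof -
    have "2 - t = 2 * (1 - u)" using u by simp
    thus ?thesis unfolding u(2) using u(3) by (simp add: divide_simps) (simp add: algebra_simps power2_eq_square)
  qed
  ultimately show ?thesis by simp
qed

lemma conv_radius_frob_rhs: "fps_conv_radius (frob_rhs_fps a c2 c3) \<ge> 2"
  unfolding fps_conv_radius_def
proof (rule conv_radius_geI_ex)
  fix r assume r: "0 < r" "ereal r < 2"
  hence "\<bar>r\<bar> < 2" by simp
  from frob_rhs_sums[OF this] r show "\<exists>z. norm z = r \<and> summable (\<lambda>n. fps_nth (frob_rhs_fps a c2 c3) n * z ^ n)"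
    by (intro exI[of _ r]) (auto simp: sums_iff)
qed

text \<open>This is the equation for phi after removing the factor t^((1+a)/2). Coefficientwise it
  is the recursion, since n(n-1) + (1+a) n = n (n + a).\<close>

lemma frob_fps_ode:
  assumes "a \<ge> 0"
  shows "fps_X\<^sup>2 * fps_deriv (fps_deriv (frob_fps a c2 c3)) + fps_const (1 + a) * (fps_X * fps_deriv (frob_fps a c2 c3))
     = frob_rhs_fps a c2 c3 * frob_fps a c2 c3" (is "?L = ?R")
proof (rule fps_ext)
  fix n
  have R: "fps_nth ?R n = (\<Sum>k<n. frob_rhs a c2 c3 (n - k) * frob a c2 c3 k)"
  proof -
    have "fps_nth ?R n = (\<Sum>i=0..n. fps_nth (frob_fps a c2 c3) i * fps_nth (frob_rhs_fps a c2 c3) (n - i))"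
      by (subst mult.commute) (simp add: fps_mult_nth)
    also have "\<dots> = (\<Sum>k<n. frob a c2 c3 k * frob_rhs a c2 c3 (n - k))"
      by (rule sum.mono_neutral_cong_right) (auto simp: frob_fps_def frob_rhs_fps_def)
    finally show ?thesis by (simp add: mult.commute)
  qed
  have L: "fps_nth ?L n = real n * (real n + a) * frob a c2 c3 n"
  proof -
    consider "n = 0" | "n = 1" | m where "n = Suc (Suc m)"
      by (metis One_nat_def nat.exhaust)
    thus ?thesis
    proof cases
      case 3
      thus ?thesis
        by (simp add: fps_X_power_mult_nth frob_fps_def numeral_2_eq_2 algebra_simps)
    qed (simp_all add: fps_X_power_mult_nth frob_fps_def)
  qed
  show "fps_nth ?L n = fps_nth ?R n"
  proof (cases "n = 0")
    case False
    hence "real n * (real n + a) \<noteq> 0" using assms by auto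
    thus ?thesis unfolding L R using frob_rec[of n a c2 c3] False by simp
  next
    case True
    show ?thesis unfolding L R by (simp add: True)
  qed
qed

definition frob_fun :: "real \<Rightarrow> real \<Rightarrow> real \<Rightarrow> real \<Rightarrow> real" where
  "frob_fun a c2 c3 = eval_fps (frob_fps a c2 c3)"

definition frob_fun1 :: "real \<Rightarrow> real \<Rightarrow> real \<Rightarrow> real \<Rightarrow> real" where
  "frob_fun1 a c2 c3 = eval_fps (fps_deriv (frob_fps a c2 c3))"

definition frob_fun2 :: "real \<Rightarrow> real \<Rightarrow> real \<Rightarrow> real \<Rightarrow> real" where
  "frob_fun2 a c2 c3 = eval_fps (fps_deriv (fps_deriv (frob_fps a c2 c3)))"

lemma less_conv_radius_frob:
  fixes t :: real
  assumes "a \<ge> 0" "\<bar>t\<bar> < 2"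
  shows "ereal (norm t) < fps_conv_radius (frob_fps a c2 c3)"
    "ereal (norm t) < fps_conv_radius (fps_deriv (frob_fps a c2 c3))"
    "ereal (norm t) < fps_conv_radius (fps_deriv (fps_deriv (frob_fps a c2 c3)))"
proof -
  have "ereal (norm t) < 2" using assms(2) by simp
  also note conv_radius_frob[OF assms(1), of c2 c3]
  finally show 1: "ereal (norm t) < fps_conv_radius (frob_fps a c2 c3)" .
  also note fps_conv_radius_deriv
  finally show 2: "ereal (norm t) < fps_conv_radius (fps_deriv (frob_fps a c2 c3))" .
  also note fps_conv_radius_deriv
  finally show "ereal (norm t) < fps_conv_radius (fps_deriv (fps_deriv (frob_fps a c2 c3)))" .
qed

lemma has_derivative_frob_fun:
  assumes "a \<ge> 0" "\<bar>t\<bar> < 2"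
  shows "(frob_fun a c2 c3 has_real_derivative frob_fun1 a c2 c3 t) (at t)"
    "(frob_fun1 a c2 c3 has_real_derivative frob_fun2 a c2 c3 t) (at t)"
  unfolding frob_fun_def frob_fun1_def frob_fun2_def
  by (intro has_field_derivative_eval_fps less_conv_radius_frob assms)+

lemma continuous_on_frob_fun:
  assumes "a \<ge> 0" "S \<subseteq> {-2<..<2}"
  shows "continuous_on S (frob_fun a c2 c3)" "continuous_on S (frob_fun1 a c2 c3)"
proof -
  have "\<bar>t\<bar> < 2" if "t \<in> S" for t using that assms(2) by (auto simp: abs_less_iff)
  thus "continuous_on S (frob_fun a c2 c3)" "continuous_on S (frob_fun1 a c2 c3)"
    using has_derivative_frob_fun[OF assms(1)]
    by (meson DERIV_isCont continuous_at_imp_continuous_on)+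
qed

lemma frob_fun_0 [simp]: "frob_fun a c2 c3 0 = 1"
  by (simp add: frob_fun_def eval_fps_at_0 frob_fps_def)

lemma frob_fun_at_1:
  assumes "a \<ge> 0"
  shows "frob_fun a c2 c3 1 = frob_sum a c2 c3" "frob_fun1 a c2 c3 1 = frob_dsum a c2 c3"
proof -
  show "frob_fun a c2 c3 1 = frob_sum a c2 c3"
    by (simp add: frob_fun_def eval_fps_def frob_fps_def frob_sum_def)
  show "frob_fun1 a c2 c3 1 = frob_dsum a c2 c3"
    using suminf_split_head[OF summable_frob(2)[OF assms, of c2 c3]]
    by (simp add: frob_fun1_def eval_fps_def frob_fps_def frob_dsum_def)
qed

lemma frob_fun_ode:
  assumes "a \<ge> 0" "\<bar>t\<bar> < 2"
  shows "t\<^sup>2 * frob_fun2 a c2 c3 t + (1 + a) * (t * frob_fun1 a c2 c3 t) =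
     t * ((a\<^sup>2 - 1 + 2 * c3) * (2 - t) + 2 * c2) / (4 * (2 - t)\<^sup>2) * frob_fun a c2 c3 t"
proof -
  note r = less_conv_radius_frob[OF assms, of c2 c3]
  have rG: "ereal (norm t) < fps_conv_radius (frob_rhs_fps a c2 c3)"
    by (rule less_le_trans[OF _ conv_radius_frob_rhs]) (use assms(2) in simp)
  have rm: "ereal (norm t) < fps_conv_radius (f * g)"
    if "ereal (norm t) < fps_conv_radius f" "ereal (norm t) < fps_conv_radius g" for f g :: "real fps"
    by (rule less_le_trans[OF _ fps_conv_radius_mult]) (use that in simp)
  let ?F1 = "fps_deriv (frob_fps a c2 c3)"
  have X2: "eval_fps (fps_X\<^sup>2 * fps_deriv ?F1) t = t\<^sup>2 * frob_fun2 a c2 c3 t"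
    unfolding frob_fun2_def by (subst eval_fps_mult) (use r in auto)
  have X1: "eval_fps (fps_X * ?F1) t = t * frob_fun1 a c2 c3 t"
    unfolding frob_fun1_def by (subst eval_fps_mult) (use r in auto)
  have c: "eval_fps (fps_const (1 + a) * (fps_X * ?F1)) t = (1 + a) * (t * frob_fun1 a c2 c3 t)"
  proof -
    have "eval_fps (fps_const (1 + a) * (fps_X * ?F1)) t = eval_fps (fps_const (1 + a)) t * eval_fps (fps_X * ?F1) t"
      by (rule eval_fps_mult) (simp, rule rm, simp, rule r)
    thus ?thesis by (simp only: X1 eval_fps_const)
  qed
  have "eval_fps (fps_X\<^sup>2 * fps_deriv ?F1 + fps_const (1 + a) * (fps_X * ?F1)) t =
     t\<^sup>2 * frob_fun2 a c2 c3 t + (1 + a) * (t * frob_fun1 a c2 c3 t)"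
    unfolding X2[symmetric] c[symmetric]
    by (rule eval_fps_add) ((rule rm r | simp)+)
  moreover have "eval_fps (frob_rhs_fps a c2 c3 * frob_fps a c2 c3) t =
     t * ((a\<^sup>2 - 1 + 2 * c3) * (2 - t) + 2 * c2) / (4 * (2 - t)\<^sup>2) * frob_fun a c2 c3 t"
    unfolding frob_fun_def eval_fps_mult[OF rG r(1)]
    using sums_unique[OF frob_rhs_sums[OF assms(2), of a c2 c3]] by (simp only: eval_fps_def)
  ultimately show ?thesis using frob_fps_ode[OF assms(1), of c2 c3] by simp
qed

section \<open>The extremal solutions\<close>

lemma DERIV_powr_log:
  "(t::real) > 0 \<Longrightarrow> ((\<lambda>t. t powr r) has_real_derivative t powr r * (r / t)) (at t)"
  using has_real_derivative_powr[of t r] by (simp add: powr_diff field_simps)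

lemma DERIV_shift_1:
  "(f has_real_derivative d) (at (1 + x)) \<Longrightarrow> ((\<lambda>x. f (1 + x)) has_real_derivative d) (at x)"
  using DERIV_shift[of f d x 1] by (simp add: add.commute)

text \<open>The left-hand side of the condition on \<open>c3\<close> is 2 (c_3 - c3bar). Before the
  first zero \<open>z\<close> the quotient \<open>u\<close> cannot decrease, yet it starts positive
  and would have to satisfy \<open>u z <= 0\<close>.\<close>

lemma frob_fun_pos:
  assumes a: "a \<ge> 0" and b: "b \<ge> 0" and c3: "2 * c3 + (a + b)\<^sup>2 + 2 * (a + b) \<ge> 0"
    and t: "0 \<le> t" "t < 2"
  shows "frob_fun a (b\<^sup>2 - 1) c3 t > 0"
proof (rule ccontr)
  let ?h = "frob_fun a (b\<^sup>2 - 1) c3" and ?h1 = "frob_fun1 a (b\<^sup>2 - 1) c3"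
    and ?h2 = "frob_fun2 a (b\<^sup>2 - 1) c3"
  have cont: "continuous_on {0..t} ?h" "continuous_on {0..t} ?h1"
    using t by (auto intro!: continuous_on_frob_fun a)
  assume "\<not> ?h t > 0"
  define Z where "Z = {s \<in> {0..t}. ?h s \<le> 0}"
  have "t \<in> Z" using \<open>\<not> ?h t > 0\<close> t by (auto simp: Z_def)
  moreover have "compact Z"
  proof -
    have "closed Z"
      using continuous_closed_preimage[OF cont(1), of "{..0}"]
      by (simp add: Z_def vimage_def Collect_conj_eq[symmetric] Int_def)
    moreover have "bounded Z" by (rule bounded_subset[of "{0..t}"]) (auto simp: Z_def)
    ultimately show ?thesis by (simp add: compact_eq_bounded_closed)
  qed
  ultimately obtain z where z: "z \<in> Z" "\<And>s. s \<in> Z \<Longrightarrow> z \<le> s"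
    using compact_attains_inf[of Z] by blast
  have zt: "0 \<le> z" "z \<le> t" "?h z \<le> 0" using z(1) by (auto simp: Z_def)
  have pos: "?h s > 0" if "0 \<le> s" "s < z" for s
    using z(2)[of s] that zt by (auto simp: Z_def not_less[symmetric])
  define \<sigma> where "\<sigma> = (1 + b) / 2"
  \<comment> \<open>\<open>u\<close> is the quotient by the explicit solution, \<open>v\<close> the Wronskian of the two; \<open>v' \<ge> 0\<close> as long as
    the solution is positive.\<close>
  define y where "y = (\<lambda>s. ?h1 s + \<sigma> * ?h s / (2 - s))"
  define v where "v = (\<lambda>s. s powr (1 + a) * ((2 - s) powr \<sigma> * y s))"
  define u where "u = (\<lambda>s. ?h s * (2 - s) powr (-\<sigma>))"
  have sub: "{0..z} \<subseteq> {0..t}" using zt by auto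
  note cont' = continuous_on_subset[OF cont(1) sub] continuous_on_subset[OF cont(2) sub]
  have powr2: "((\<lambda>s. (2 - s) powr r) has_real_derivative - ((2 - s) powr r * (r / (2 - s)))) (at s)"
    if "s < 2" for s r
  proof -
    have "((\<lambda>s. 2 - s) has_real_derivative -1) (at s)" by (auto intro!: derivative_eq_intros)
    moreover have "((\<lambda>t. t powr r) has_real_derivative (2 - s) powr r * (r / (2 - s))) (at (2 - s))"
      by (rule DERIV_powr_log) (use that in simp)
    ultimately show ?thesis using DERIV_chain2 by force
  qed
  have cont_y: "continuous_on {0..z} y"
    unfolding y_def using zt t by (intro continuous_intros cont') auto
  have v_nonneg: "v s \<ge> 0" if s: "0 \<le> s" "s < z" for s
  proof -
    \<comment> \<open>The factor \<open>s powr (1 + a)\<close> vanishes at 0, so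
      \<open>v 0 = 0\<close> and monotonicity alone gives the sign of \<open>v\<close>.\<close>
    have "v 0 \<le> v s"
    proof (rule DERIV_nonneg_imp_increasing_open[OF s(1)])
      fix r assume r: "0 < r" "r < s"
      hence r2: "r < 2" "\<bar>r\<bar> < 2" "2 - r > 0" using s zt t by auto
      have y': "(y has_real_derivative (?h2 r + (\<sigma> * ?h1 r * (2 - r) + \<sigma> * ?h r) / (2 - r)\<^sup>2)) (at r)"
        unfolding y_def using r2
        by (auto intro!: derivative_eq_intros has_derivative_frob_fun[OF a] simp: power2_eq_square)
      let ?d = "r powr (1 + a) * (2 - r) powr \<sigma> * ((1 + a) / r * y r - \<sigma> / (2 - r) * y r 
          + (?h2 r + (\<sigma> * ?h1 r * (2 - r) + \<sigma> * ?h r) / (2 - r)\<^sup>2))"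
      have v': "(v has_real_derivative ?d) (at r)"
        using DERIV_mult[OF DERIV_powr_log[OF r(1)] DERIV_mult[OF powr2[OF r2(1)] y']]
        unfolding v_def by (rule DERIV_cong) (simp add: algebra_simps)
      have ode: "r * ?h2 r + (1 + a) * ?h1 r = 
          ((a\<^sup>2 - 1 + 2 * c3) * (2 - r) + 2 * (b\<^sup>2 - 1)) / (4 * (2 - r)\<^sup>2) * ?h r" (is "?l = ?q * _")
      proof -
        have "r * ?l = r * (?q * ?h r)"
          using frob_fun_ode[OF a r2(2), of "b\<^sup>2 - 1" c3] 
          by (simp add: algebra_simps power2_eq_square)
        from mult_left_cancel[THEN iffD1, OF _ this] r show ?thesis by simp
      qed
      have "r * ((1 + a) / r * y r - \<sigma> / (2 - r) * y r 
          + (?h2 r + (\<sigma> * ?h1 r * (2 - r) + \<sigma> * ?h r) / (2 - r)\<^sup>2))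
          = ?l + ?h r * ((1 + a) * \<sigma> / (2 - r) - r * \<sigma>\<^sup>2 / (2 - r)\<^sup>2 + r * \<sigma> / (2 - r)\<^sup>2)"
      proof -
        have "r * ((1 + a) / r * (h1 + \<sigma> * h / q) - \<sigma> / q * (h1 + \<sigma> * h / q) + (h2 + (\<sigma> * h1 * q + \<sigma> * h) / q\<^sup>2))
          = (r * h2 + (1 + a) * h1) + h * ((1 + a) * \<sigma> / q - r * \<sigma>\<^sup>2 / q\<^sup>2 + r * \<sigma> / q\<^sup>2)"
          if "q > 0" for h h1 h2 q :: real
          using that r(1) by (simp add: field_simps power2_eq_square)
        from this[OF r2(3)] show ?thesis unfolding y_def .
      qed
      also have "\<dots> = ?h r * (?q + ((1 + a) * \<sigma> / (2 - r) - r * \<sigma>\<^sup>2 / (2 - r)\<^sup>2 + r * \<sigma> / (2 - r)\<^sup>2))"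
        unfolding ode by (simp add: algebra_simps)
      \<comment> \<open>With \<open>\<sigma> = (1 + b) / 2\<close> the terms in 1 / (2-r)^2 cancel,
        and what remains is a nonnegative multiple of c_3 - c3bar.\<close>
      also have "?q + ((1 + a) * \<sigma> / (2 - r) - r * \<sigma>\<^sup>2 / (2 - r)\<^sup>2 + r * \<sigma> / (2 - r)\<^sup>2) =
          (2 * c3 + (a + b)\<^sup>2 + 2 * (a + b)) / (4 * (2 - r))"
        using r2 unfolding \<sigma>_def by (simp add: divide_simps) (simp add: power2_eq_square algebra_simps)
      also have "?h r * \<dots> \<ge> 0" using c3 r2 pos[of r] r s by simp
      finally have "(1 + a) / r * y r - \<sigma> / (2 - r) * y r 
          + (?h2 r + (\<sigma> * ?h1 r * (2 - r) + \<sigma> * ?h r) / (2 - r)\<^sup>2) \<ge> 0"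
        using r by (simp only: zero_le_mult_iff) linarith
      hence "?d \<ge> 0" by (intro mult_nonneg_nonneg) auto
      with v' show "\<exists>d. (v has_real_derivative d) (at r) \<and> 0 \<le> d" by blast
    next
      have "{0..s} \<subseteq> {0..z}" using s by auto
      thus "continuous_on {0..s} v"
        unfolding v_def using s zt t a
        by (intro continuous_on_mult continuous_on_powr' continuous_on_subset[OF cont_y] continuous_intros) auto
    qed
    thus ?thesis by (simp add: v_def)
  qed
  have "u 0 \<le> u z"
  proof (rule DERIV_nonneg_imp_increasing_open[OF zt(1)])
    fix s assume s: "0 < s" "s < z"
    hence s2: "s < 2" "\<bar>s\<bar> < 2" "2 - s > 0" using zt t by auto
    have "(u has_real_derivative (2 - s) powr (-\<sigma>) * y s) (at s)"
      using DERIV_mult[OF has_derivative_frob_fun(1)[OF a s2(2)] powr2[OF s2(1)]]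
      unfolding u_def y_def by (rule DERIV_cong) (simp add: algebra_simps)
    moreover have "y s \<ge> 0"
      using v_nonneg[of s] s s2 by (simp add: v_def zero_le_mult_iff)
    ultimately show "\<exists>d. (u has_real_derivative d) (at s) \<and> 0 \<le> d" by (auto intro!: exI)
  next
    show "continuous_on {0..z} u"
      unfolding u_def using zt t by (intro continuous_intros cont') auto
  qed
  moreover have "u 0 > 0" by (simp add: u_def)
  moreover have "u z \<le> 0" using zt by (simp add: u_def mult_nonpos_nonneg)
  ultimately show False by simp
qed

text \<open>This is 2 (1-x^2) phi'/phi with phi'/phi = (1+a)/(2t) + h'/h; the pole at t = 0 has been
  cancelled against 1-x^2 = t (2-t).\<close>

definition frob_sol :: "real \<Rightarrow> real \<Rightarrow> real \<Rightarrow> real \<Rightarrow> real" where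
  "frob_sol a c2 c3 x = (1 + a) * (1 - x) + 2 * (1 - x\<^sup>2) * (frob_fun1 a c2 c3 (1 + x) / frob_fun a c2 c3 (1 + x))"

lemma is_sol_frob_sol:
  assumes a: "a \<ge> 0" and pos: "\<forall>t\<in>{0..<2}. frob_fun a c2 c3 t > 0"
  shows "is_sol (a\<^sup>2 - 1, c2, c3) (frob_sol a c2 c3)"
  unfolding is_sol_def
proof
  fix x :: real assume x: "x \<in> {-1<..<1}"
  let ?h = "frob_fun a c2 c3 (1 + x)" and ?h1 = "frob_fun1 a c2 c3 (1 + x)" and ?h2 = "frob_fun2 a c2 c3 (1 + x)"
  have t: "\<bar>1 + x\<bar> < 2" "1 + x > 0" "1 - x > 0" and h: "?h > 0" using x bspec[OF pos, of "1 + x"] by auto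
  define w where "w = ?h1 / ?h"
  define k where "k = ?h2 / ?h"
  have "((\<lambda>x. frob_fun1 a c2 c3 (1 + x) / frob_fun a c2 c3 (1 + x)) has_real_derivative
      (?h2 * ?h - ?h1 * ?h1) / (?h * ?h)) (at x)"
    using h by (intro DERIV_divide DERIV_shift_1 has_derivative_frob_fun[OF a t(1)]) auto
  also have "(?h2 * ?h - ?h1 * ?h1) / (?h * ?h) = k - w\<^sup>2"
    using h by (simp add: k_def w_def field_simps power2_eq_square)
  finally have w': "((\<lambda>x. frob_fun1 a c2 c3 (1 + x) / frob_fun a c2 c3 (1 + x)) has_real_derivative (k - w\<^sup>2)) (at x)" .
  have "(frob_sol a c2 c3 has_real_derivative (- (1 + a) - 4 * x * w + 2 * (1 - x\<^sup>2) * (k - w\<^sup>2))) (at x)"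
  proof -
    have "((\<lambda>x. (1 + a) * (1 - x)) has_real_derivative - (1 + a)) (at x)"
      "((\<lambda>x. 2 * (1 - x\<^sup>2)) has_real_derivative - 4 * x) (at x)"
      by (auto intro!: derivative_eq_intros)
    from DERIV_add[OF this(1) DERIV_mult[OF this(2) w']] show ?thesis
      unfolding frob_sol_def by (rule DERIV_cong) (simp add: w_def)
  qed
  moreover have "(1 - x\<^sup>2) * (- (1 + a) - 4 * x * w + 2 * (1 - x\<^sup>2) * (k - w\<^sup>2)) + 2 * x * frob_sol a c2 c3 x
       + (frob_sol a c2 c3 x)\<^sup>2 / 2 = Pc (a\<^sup>2 - 1, c2, c3) x"
  proof -
    let ?N = "(a\<^sup>2 - 1 + 2 * c3) * (1 - x) + 2 * c2"
    have "2 - (1 + x) = 1 - x" "?h2 = k * ?h" "?h1 = w * ?h" using h by (simp_all add: k_def w_def)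
    from frob_fun_ode[OF a t(1), of c2 c3, unfolded this]
    have "4 * (1 - x)\<^sup>2 * ((1 + x)\<^sup>2 * (k * ?h) + (1 + a) * ((1 + x) * (w * ?h))) = (1 + x) * (?h * ?N)"
      using t(3) by simp
    moreover have "4 * (1 - x)\<^sup>2 * ((1 + x)\<^sup>2 * (k * ?h) + (1 + a) * ((1 + x) * (w * ?h))) =
        (1 + x) * (?h * (4 * (1 - x)\<^sup>2 * ((1 + x) * k + (1 + a) * w)))"
      by (simp add: power2_eq_square algebra_simps)
    ultimately have "(1 + x) * (?h * (4 * (1 - x)\<^sup>2 * ((1 + x) * k + (1 + a) * w))) = (1 + x) * (?h * ?N)"
      by simp
    hence E: "4 * (1 - x)\<^sup>2 * ((1 + x) * k + (1 + a) * w) = (a\<^sup>2 - 1 + 2 * c3) * (1 - x) + 2 * c2" 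
      using h t(2) by simp
    have U: "frob_sol a c2 c3 x = (1 + a) * (1 - x) + 2 * (1 - x\<^sup>2) * w"
      by (simp add: frob_sol_def w_def)
    \<comment> \<open>The terms in w^2 cancel, and the defect in the Riccati equation becomes
      (1+x)/2 times the defect in the linear equation \<open>E\<close>.\<close>
    have "(1 - x\<^sup>2) * (- (1 + a) - 4 * x * w + 2 * (1 - x\<^sup>2) * (k - w\<^sup>2)) + 2 * x * frob_sol a c2 c3 x
       + (frob_sol a c2 c3 x)\<^sup>2 / 2 - Pc (a\<^sup>2 - 1, c2, c3) x = (1 + x) / 2 *
       (4 * (1 - x)\<^sup>2 * ((1 + x) * k + (1 + a) * w) - ((a\<^sup>2 - 1 + 2 * c3) * (1 - x) + 2 * c2))"
      unfolding U Pc_def by (simp add: field_simps power2_eq_square)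
    thus ?thesis unfolding E by simp
  qed
  ultimately show "\<exists>d. (frob_sol a c2 c3 has_real_derivative d) (at x) \<and>
      (1 - x\<^sup>2) * d + 2 * x * frob_sol a c2 c3 x + (frob_sol a c2 c3 x)\<^sup>2 / 2 = Pc (a\<^sup>2 - 1, c2, c3) x"
    by blast
qed

lemma frob_sol_greatest:
  assumes a: "a \<ge> 0" and pos: "\<forall>t\<in>{0..<2}. frob_fun a c2 c3 t > 0"
    and V: "is_sol (a\<^sup>2 - 1, c2, c3) V" and x0: "x0 \<in> {-1<..<1}"
  shows "V x0 \<le> frob_sol a c2 c3 x0"
proof (rule ccontr)
  let ?h = "\<lambda>x. frob_fun a c2 c3 (1 + x)" and ?h1 = "\<lambda>x. frob_fun1 a c2 c3 (1 + x)"
  define U where "U = frob_sol a c2 c3"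
  \<comment> \<open>\<open>\<Phi>\<close> is phi^2. Its logarithmic derivative is U / (1-x^2);
    together with the factor 1 / (1-x^2) in \<open>E\<close> this removes every term linear in V - U
    from the derivative of \<open>E\<close>.\<close>
  define \<Phi> where "\<Phi> = (\<lambda>x. (1 + x) powr (1 + a) * (?h x)\<^sup>2)"
  define E where "E = (\<lambda>x. (V x - U x) * \<Phi> x / (1 - x\<^sup>2))"
  assume "\<not> V x0 \<le> frob_sol a c2 c3 x0"
  hence VU: "V x0 > U x0" by (simp add: U_def)
  have m_pos: "1 - x\<^sup>2 > 0" if "x \<in> {-1<..<1}" for x :: real
    using that by (auto simp: abs_square_less_1 abs_less_iff)
  have \<Phi>_pos: "\<Phi> x > 0" if "x \<in> {-1<..<1}" for x
    using that bspec[OF pos, of "1 + x"] by (auto simp: \<Phi>_def)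
  have E': "(E has_real_derivative - ((E x)\<^sup>2 / (2 * \<Phi> x))) (at x)" if x: "x \<in> {-1<..<1}" for x
  proof -
    let ?m = "1 - x\<^sup>2"
    obtain du where du: "(U has_real_derivative du) (at x)" 
        "?m * du + 2 * x * U x + (U x)\<^sup>2 / 2 = Pc (a\<^sup>2 - 1, c2, c3) x"
      using is_sol_frob_sol[OF a pos] x unfolding is_sol_def U_def by blast
    obtain dv where dv: "(V has_real_derivative dv) (at x)" 
        "?m * dv + 2 * x * V x + (V x)\<^sup>2 / 2 = Pc (a\<^sup>2 - 1, c2, c3) x"
      using V x unfolding is_sol_def by blast
    have h: "?h x > 0" and t: "\<bar>1 + x\<bar> < 2" "1 + x > 0" "1 - x > 0" using bspec[OF pos, of "1 + x"] x by auto
    have m: "?m > 0" by (rule m_pos[OF x])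
    have "(\<Phi> has_real_derivative (1 + x) powr (1 + a) * ((1 + a) / (1 + x)) * (?h x)\<^sup>2 
        + (1 + x) powr (1 + a) * (2 * ?h x * ?h1 x)) (at x)"
      using DERIV_mult[OF DERIV_shift_1[OF DERIV_powr_log[OF t(2), of "1 + a"]]
          DERIV_power[OF DERIV_shift_1[OF has_derivative_frob_fun(1)[OF a t(1), of c2 c3]], of 2]]
      unfolding \<Phi>_def by (rule DERIV_cong) (simp add: algebra_simps)
    also have "(1 + x) powr (1 + a) * ((1 + a) / (1 + x)) * (?h x)\<^sup>2 
        + (1 + x) powr (1 + a) * (2 * ?h x * ?h1 x) = \<Phi> x * (U x / ?m)"
    proof -
      have *: "U x / ?m = (1 + a) / (1 + x) + 2 * ?h1 x / ?h x"
      proof -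
        have "?m = (1 + x) * (1 - x)" by (simp add: algebra_simps power2_eq_square)
        thus ?thesis using t h unfolding U_def frob_sol_def by (simp add: add_divide_distrib)
      qed
      show ?thesis unfolding * \<Phi>_def using h by (simp add: field_simps power2_eq_square)
    qed
    finally have \<Phi>': "(\<Phi> has_real_derivative \<Phi> x * (U x / ?m)) (at x)" .
    have "(E has_real_derivative (((dv - du) * \<Phi> x + \<Phi> x * (U x / ?m) * (V x - U x)) * ?m 
        - (V x - U x) * \<Phi> x * (- (2 * x))) / (?m * ?m)) (at x)"
      unfolding E_def using m
      by (intro DERIV_divide DERIV_mult DERIV_diff dv du \<Phi>') (auto intro!: derivative_eq_intros)
    also have "((dv - du) * \<Phi> x + \<Phi> x * (U x / ?m) * (V x - U x)) * ?m 
        - (V x - U x) * \<Phi> x * (- (2 * x)) = 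
        \<Phi> x * (?m * (dv - du) + U x * (V x - U x) + 2 * x * (V x - U x))"
      using m by (simp add: field_simps)
    also have "?m * (dv - du) + U x * (V x - U x) + 2 * x * (V x - U x) = - ((V x - U x)\<^sup>2 / 2)"
      using du(2) dv(2) by (simp add: field_simps power2_eq_square)
    also have "\<Phi> x * - ((V x - U x)\<^sup>2 / 2) / (?m * ?m) = - ((E x)\<^sup>2 / (2 * \<Phi> x))"
    proof -
      have "p * - (d\<^sup>2 / 2) / (m * m) = - ((d * p / m)\<^sup>2 / (2 * p))" if "p > 0" "m > 0" for p d m :: real
        using that by (simp add: field_simps power2_eq_square)
      from this[OF \<Phi>_pos[OF x] m] show ?thesis unfolding E_def .
    qed
    finally show ?thesis .
  qed
  have "E x0 > 0" using VU m_pos[OF x0] \<Phi>_pos[OF x0] by (simp add: E_def)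
  \<comment> \<open>\<open>E\<close> is nonincreasing, so to the left of \<open>x0\<close> it stays
    above \<open>E x0\<close>, and \<open>inverse (E x)\<close> remains positive all the way to
    -1.\<close>
  have E_pos: "E x > 0" if "-1 < x" "x \<le> x0" for x
  proof -
    have "E x0 \<le> E x"
    proof (rule DERIV_nonpos_imp_nonincreasing[OF that(2)])
      fix s assume "x \<le> s" "s \<le> x0"
      hence s: "s \<in> {-1<..<1}" using that x0 by auto
      from E'[OF s] \<Phi>_pos[OF s] show "\<exists>y. (E has_real_derivative y) (at s) \<and> y \<le> 0"
        by (intro exI[of _ "- ((E s)\<^sup>2 / (2 * \<Phi> s))"]) simp
    qed
    with \<open>E x0 > 0\<close> show ?thesis by simp
  qed
  have "continuous_on {0..1} (frob_fun a c2 c3)"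
    by (intro continuous_on_frob_fun a) auto
  hence "bounded (frob_fun a c2 c3 ` {0..1})"
    by (intro compact_imp_bounded compact_continuous_image) auto
  then obtain B where B: "B > 0" "\<And>t. t \<in> {0..1} \<Longrightarrow> norm (frob_fun a c2 c3 t) \<le> B"
    unfolding bounded_pos by blast
  define C where "C = B\<^sup>2"
  have "C > 0" using B by (simp add: C_def)
  have \<Phi>_le: "\<Phi> x \<le> C * (1 + x)" if "-1 < x" "x \<le> 0" for x
  proof -
    have "(1 + x) powr (1 + a) = (1 + x) * (1 + x) powr a"
      using that by (simp add: powr_add)
    also have "\<dots> \<le> (1 + x) * 1"
      using that a by (intro mult_left_mono powr_le1) auto
    finally have "(1 + x) powr (1 + a) \<le> 1 + x" by simp
    moreover have "(?h x)\<^sup>2 \<le> C"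
      unfolding C_def using B(2)[of "1 + x"] that by (intro abs_le_square_iff[THEN iffD1]) auto
    ultimately have "\<Phi> x \<le> (1 + x) * C"
      unfolding \<Phi>_def using that by (intro mult_mono) auto
    thus ?thesis by (simp add: mult.commute)
  qed
  \<comment> \<open>Left of \<open>x1\<close> both the positivity of \<open>E\<close> and the bound
    \<open>\<Phi> x <= C * (1 + x)\<close> are available. The bound makes 1/E grow at least as fast
    as ln (1+x) / (2C), so \<open>G\<close> is nondecreasing there.\<close>
  define x1 where "x1 = min x0 0"
  define G where "G = (\<lambda>x. inverse (E x) - ln (1 + x) / (2 * C))"
  have x1: "-1 < x1" "x1 \<le> x0" "x1 \<le> 0" "x1 < 1" using x0 by (auto simp: x1_def)
  have G_mono: "G x \<le> G x1" if x: "-1 < x" "x \<le> x1" for x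
  proof (rule DERIV_nonneg_imp_nondecreasing[OF x(2)])
    fix s assume "x \<le> s" "s \<le> x1"
    hence s: "-1 < s" "s \<le> x1" "s \<in> {-1<..<1}" using x x1 by auto
    have Es: "E s > 0" using E_pos s x1 by auto
    have "(G has_real_derivative (1 / (2 * \<Phi> s) - 1 / (2 * C * (1 + s)))) (at s)"
    proof -
      have "((\<lambda>x. inverse (E x)) has_real_derivative 1 / (2 * \<Phi> s)) (at s)"
        using DERIV_inverse'[OF E'[OF s(3)]] Es
        by (auto elim!: DERIV_cong simp: field_simps power2_eq_square)
      moreover have "((\<lambda>x. ln (1 + x) / (2 * C)) has_real_derivative 1 / (2 * C * (1 + s))) (at s)"
        using s \<open>C > 0\<close> by (auto intro!: derivative_eq_intros)
      ultimately show ?thesis unfolding G_def by (rule DERIV_diff)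
    qed
    moreover have "1 / (2 * C * (1 + s)) \<le> 1 / (2 * \<Phi> s)"
      using \<Phi>_le[of s] s x1 \<Phi>_pos[OF s(3)] \<open>C > 0\<close> by (intro divide_left_mono) auto
    ultimately show "\<exists>y. (G has_real_derivative y) (at s) \<and> 0 \<le> y"
      by (intro exI[of _ "1 / (2 * \<Phi> s) - 1 / (2 * C * (1 + s))"]) simp
  qed
  \<comment> \<open>So close to the endpoint that - ln t / (2C) exceeds
    \<open>\<bar>G x1\<bar>\<close>; with 1/E positive this forces
    \<open>G (t - 1) > G x1\<close>.\<close>
  define t where "t = min (1 + x1) (exp (- (2 * C * (\<bar>G x1\<bar> + 1))))"
  have t: "t > 0" "t \<le> 1 + x1" using x1 by (auto simp: t_def)
  have "ln t \<le> ln (exp (- (2 * C * (\<bar>G x1\<bar> + 1))))"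
    using t(1) by (subst ln_le_cancel_iff) (auto simp: t_def)
  hence "ln t / (2 * C) \<le> - (\<bar>G x1\<bar> + 1)"
    using \<open>C > 0\<close> by (subst pos_divide_le_eq) (simp_all add: algebra_simps)
  moreover have "G (t - 1) \<le> G x1" using t by (intro G_mono) auto
  moreover have "inverse (E (t - 1)) > 0" using E_pos[of "t - 1"] t x1 by auto
  moreover have "G (t - 1) = inverse (E (t - 1)) - ln t / (2 * C)" by (simp add: G_def)
  ultimately show False by linarith
qed

text \<open>The sign in front of \<open>U\<close> restores the form of the equation after reflection
  and also reverses the order, so largest solutions become smallest ones.\<close>

lemma is_sol_reflect:
  assumes "is_sol (c1, c2, c3) U"
  shows "is_sol (c2, c1, c3) (\<lambda>x. - U (- x))"
  unfolding is_sol_def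
proof
  fix x :: real assume "x \<in> {-1<..<1}"
  hence "-x \<in> {-1<..<1}" by auto
  then obtain d where d: "(U has_real_derivative d) (at (-x))" 
     "(1 - (-x)\<^sup>2) * d + 2 * (-x) * U (-x) + (U (-x))\<^sup>2 / 2 = Pc (c1, c2, c3) (-x)"
    using assms unfolding is_sol_def by blast
  have "((\<lambda>x. - U (- x)) has_real_derivative d) (at x)"
    using DERIV_minus[OF DERIV_mirror[THEN iffD1, OF d(1)]] by simp
  moreover have "(1 - x\<^sup>2) * d + 2 * x * (- U (- x)) + (- U (- x))\<^sup>2 / 2 = Pc (c2, c1, c3) x"
    using d(2) by (simp add: Pc_def algebra_simps)
  ultimately show "\<exists>d. ((\<lambda>x. - U (- x)) has_real_derivative d) (at x) \<and>
      (1 - x\<^sup>2) * d + 2 * x * (- U (- x)) + (- U (- x))\<^sup>2 / 2 = Pc (c2, c1, c3) x"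
    by blast
qed

section \<open>Series formulas for gamma^+ and gamma^-\<close>

definition frob_gamma :: "'a::{real_normed_field,banach} \<Rightarrow> 'a \<Rightarrow> 'a \<Rightarrow> 'a" where
  "frob_gamma a c2 c3 = 1 + a + 2 * (frob_dsum a c2 c3 / frob_sum a c2 c3)"

lemma frob_sol_0: "a \<ge> 0 \<Longrightarrow> frob_sol a c2 c3 0 = frob_gamma a c2 c3"
  by (simp add: frob_sol_def frob_gamma_def frob_fun_at_1)

lemma frob_fun_pos_Jset:
  assumes "(c1, c2, c3) \<in> Jset"
  shows "\<forall>t\<in>{0..<2}. frob_fun (sqrt (1 + c1)) c2 c3 t > 0"
proof
  fix t :: real assume "t \<in> {0..<2}"
  hence t: "0 \<le> t" "t < 2" by auto
  let ?a = "sqrt (1 + c1)" and ?b = "sqrt (1 + c2)"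
  have c: "c1 \<ge> -1" "c2 \<ge> -1" "c3 \<ge> c3bar c1 c2" using assms(1) by (auto simp: Jset_def)
  have "2 * c3 + (?a + ?b)\<^sup>2 + 2 * (?a + ?b) \<ge> 0"
    using c(3) by (simp add: c3bar_def power2_eq_square algebra_simps)
  from frob_fun_pos[OF _ _ this t] c(1,2) show "frob_fun ?a c2 c3 t > 0" by simp
qed

lemma gamma_plus_eq:
  assumes "(c1, c2, c3) \<in> Jset"
  shows "gamma_plus (c1, c2, c3) = frob_gamma (sqrt (1 + c1)) c2 c3"
proof -
  let ?U = "frob_sol (sqrt (1 + c1)) c2 c3"
  have a: "sqrt (1 + c1) \<ge> 0" "(sqrt (1 + c1))\<^sup>2 - 1 = c1" using assms by (auto simp: Jset_def)
  note pos = frob_fun_pos_Jset[OF assms]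
  have U: "is_sol (c1, c2, c3) ?U" "\<And>V x. is_sol (c1, c2, c3) V \<Longrightarrow> x \<in> {-1<..<1} \<Longrightarrow> V x \<le> ?U x"
    using is_sol_frob_sol[OF a(1) pos] frob_sol_greatest[OF a(1) pos] unfolding a(2) by blast+
  have "gamma_plus (c1, c2, c3) = ?U 0"
    unfolding gamma_plus_def
  proof (rule the_equality)
    show "\<exists>W. is_sol (c1, c2, c3) W \<and> (\<forall>V. is_sol (c1, c2, c3) V \<longrightarrow> (\<forall>x\<in>{-1<..<1}. V x \<le> W x)) \<and> W 0 = ?U 0"
      using U by blast
    fix g assume "\<exists>W. is_sol (c1, c2, c3) W \<and> (\<forall>V. is_sol (c1, c2, c3) V \<longrightarrow> (\<forall>x\<in>{-1<..<1}. V x \<le> W x)) \<and> W 0 = g"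
    then obtain W where "is_sol (c1, c2, c3) W" "\<forall>V. is_sol (c1, c2, c3) V \<longrightarrow> (\<forall>x\<in>{-1<..<1}. V x \<le> W x)" "W 0 = g"
      by blast
    moreover have "(0::real) \<in> {-1<..<1}" by simp
    ultimately show "g = ?U 0" using U by (metis order_antisym)
  qed
  thus ?thesis using frob_sol_0[OF a(1)] by simp
qed


lemma gamma_minus_eq:
  assumes "(c1, c2, c3) \<in> Jset"
  shows "gamma_minus (c1, c2, c3) = - frob_gamma (sqrt (1 + c2)) c1 c3"
proof -
  have J: "(c2, c1, c3) \<in> Jset" using assms by (auto simp: Jset_def c3bar_def add.commute)
  let ?U = "\<lambda>x. - frob_sol (sqrt (1 + c2)) c1 c3 (- x)"
  have a: "sqrt (1 + c2) \<ge> 0" "(sqrt (1 + c2))\<^sup>2 - 1 = c2" using assms by (auto simp: Jset_def)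
  note pos = frob_fun_pos_Jset[OF J]
  have U: "is_sol (c1, c2, c3) ?U"
    using is_sol_reflect[OF is_sol_frob_sol[OF a(1) pos, unfolded a(2)]] .
  have least: "?U x \<le> V x" if "is_sol (c1, c2, c3) V" "x \<in> {-1<..<1}" for V x
    using frob_sol_greatest[OF a(1) pos, unfolded a(2), OF is_sol_reflect[OF that(1)], of "- x"] that(2) by simp
  have "gamma_minus (c1, c2, c3) = ?U 0"
    unfolding gamma_minus_def
  proof (rule the_equality)
    show "\<exists>W. is_sol (c1, c2, c3) W \<and> (\<forall>V. is_sol (c1, c2, c3) V \<longrightarrow> (\<forall>x\<in>{-1<..<1}. W x \<le> V x)) \<and> W 0 = ?U 0"
      using U least by blast
    fix g assume "\<exists>W. is_sol (c1, c2, c3) W \<and> (\<forall>V. is_sol (c1, c2, c3) V \<longrightarrow> (\<forall>x\<in>{-1<..<1}. W x \<le> V x)) \<and> W 0 = g"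
    then obtain W where W: "is_sol (c1, c2, c3) W" "\<forall>V. is_sol (c1, c2, c3) V \<longrightarrow> (\<forall>x\<in>{-1<..<1}. W x \<le> V x)" "W 0 = g"
      by blast
    have "(0::real) \<in> {-1<..<1}" by simp
    from least[OF W(1) this] W U this show "g = ?U 0" by (metis order_antisym)
  qed
  thus ?thesis using frob_sol_0[OF a(1)] by simp
qed

section \<open>Smoothness\<close>

text \<open>Isolates how the exponent is continued to complex parameters: \<open>A\<close> is a
  branch of the square root away from the exceptional face and constantly 0 on it. The factor
  \<open>\<sigma>\<close> is the sign that distinguishes gamma^+ from gamma^-.\<close>

lemma smooth_on_frob_gamma:
  fixes A :: "'a::euclidean_space \<times> 'a \<Rightarrow> complex"
  assumes D: "open D" "sep_hol D A" "\<And>q. q \<in> D \<Longrightarrow> Re (A q) \<ge> 0"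
    and L: "bounded_linear L2" "bounded_linear L3"
    and S: "\<And>x. x \<in> S \<Longrightarrow> (x, 0) \<in> D" "\<And>x. x \<in> S \<Longrightarrow> A (x, 0) = of_real (a x)"
      "\<And>x. x \<in> S \<Longrightarrow> frob_sum (a x) (L2 x) (L3 x) \<noteq> 0"
      "\<And>x. x \<in> S \<Longrightarrow> f x = \<sigma> * frob_gamma (a x) (L2 x) (L3 x)"
  shows "smooth_on S f"
  unfolding smooth_on_def
proof
  fix p assume p: "p \<in> S"
  define C2 where "C2 = (\<lambda>q. Complex (L2 (fst q)) (L2 (snd q)))"
  define C3 where "C3 = (\<lambda>q. Complex (L3 (fst q)) (L3 (snd q)))"
  have C: "sep_hol D C2" "sep_hol D C3" unfolding C2_def C3_def by (intro sep_hol_linear L)+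
  have C_real: "C2 (x, 0) = of_real (L2 x)" "C3 (x, 0) = of_real (L3 x)" for x
    using L by (simp_all add: C2_def C3_def complex_of_real_def linear_0 bounded_linear.linear)
  define g where "g = (\<lambda>q. max (norm (A q)) (max (norm (C2 q)) (norm (C3 q))))"
  \<comment> \<open>A strict bound at the base point, hence an open condition: \<open>E\<close> is a
    neighbourhood of \<open>(p, 0)\<close> with bounded parameters, as the uniform majorants
    require.\<close>
  define K where "K = g (p, 0) + 1"
  define E where "E = D \<inter> g -` {..<K}"
  have "continuous_on D g"
    unfolding g_def using D(2) C by (intro continuous_intros sep_hol_imp_continuous_on)
  hence E: "open E" unfolding E_def using D(1) by (rule continuous_open_preimage) auto
  have sub: "sep_hol E A" "sep_hol E C2" "sep_hol E C3" using D(2) C by (auto intro: sep_hol_subset simp: E_def)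
  have bound: "norm (A q) \<le> K \<and> norm (C2 q) \<le> K \<and> norm (C3 q) \<le> K" if "q \<in> E" for q
    using that by (auto simp: E_def g_def)
  have Re: "Re (A q) \<ge> 0" if "q \<in> E" for q using that D(3) by (auto simp: E_def)
  define h where "h = (\<lambda>q. frob_sum (A q) (C2 q) (C3 q))"
  define h1 where "h1 = (\<lambda>q. frob_dsum (A q) (C2 q) (C3 q))"
  have h: "sep_hol E h" "sep_hol E h1"
    unfolding h_def h1_def by (rule sep_hol_frob_sums[OF E sub Re bound]; assumption)+
  define E' where "E' = E \<inter> h -` (- {0})"
  have E': "open E'" unfolding E'_def
    using sep_hol_imp_continuous_on[OF h(1)] E by (rule continuous_open_preimage) auto
  define G where "G = (\<lambda>q. of_real \<sigma> * (1 + A q + 2 * (h1 q / h q)))"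
  have "E' \<subseteq> E" by (auto simp: E'_def)
  hence G: "sep_hol E' G"
    unfolding G_def using sub(1) h
    by (intro sep_hol_mult sep_hol_add sep_hol_const sep_hol_divide sep_hol_subset[of E _ E']) (auto simp: E'_def)
  \<comment> \<open>The real points of \<open>E'\<close>. They may lie outside \<open>S\<close>;
    there the series formula itself provides the extension.\<close>
  define N where "N = (\<lambda>x. (x, 0 :: 'a)) -` E'"
  have vals: "h (x, 0) = of_real (frob_sum (a x) (L2 x) (L3 x))" 
      "Re (G (x, 0)) = f x" if "x \<in> S" for x
  proof -
    have "a x \<ge> 0" using S(2)[OF that] D(3)[OF S(1)[OF that]] by simp
    note sums = frob_sum_of_real[OF this, of "L2 x" "L3 x"]
    show "h (x, 0) = of_real (frob_sum (a x) (L2 x) (L3 x))"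
      by (simp add: h_def C_real S(2)[OF that] sums)
    have "G (x, 0) = of_real (\<sigma> * frob_gamma (a x) (L2 x) (L3 x))"
      by (simp add: G_def h_def h1_def C_real S(2)[OF that] sums frob_gamma_def)
    thus "Re (G (x, 0)) = f x" using S(4)[OF that] by simp
  qed
  have N: "open N" unfolding N_def using E' by (rule open_vimage) (intro continuous_intros)
  have "p \<in> N"
    using vals(1)[OF p] S(1,3)[OF p] by (simp add: N_def E'_def E_def K_def)
  moreover have "\<forall>k. Ck k (\<lambda>x. Re (G (x, 0))) N"
    using sep_hol_imp_Ck[OF E' G N] by (auto simp: N_def)
  ultimately show "\<exists>N g. open N \<and> p \<in> N \<and> (\<forall>k. Ck k g N) \<and> (\<forall>q\<in>S \<inter> N. g q = f q)"
    using N vals(2) by (intro exI[of _ N] exI[of _ "\<lambda>x. Re (G (x, 0))"]) auto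
qed

text \<open>For Re z > -1 the number 1 + z lies in the right half-plane, away from the cut of
  \<open>csqrt\<close>, and the principal root has nonnegative real part, as the recursion
  demands.\<close>

lemma smooth_on_frob_gamma_sqrt:
  assumes L: "bounded_linear L1" "bounded_linear L2" "bounded_linear L3"
    and S: "\<And>x. x \<in> S \<Longrightarrow> L1 x > -1"
      "\<And>x. x \<in> S \<Longrightarrow> frob_sum (sqrt (1 + L1 x)) (L2 x) (L3 x) \<noteq> 0"
      "\<And>x. x \<in> S \<Longrightarrow> f x = \<sigma> * frob_gamma (sqrt (1 + L1 x)) (L2 x) (L3 x)"
  shows "smooth_on S f"
proof (rule smooth_on_frob_gamma[OF _ _ _ L(2,3) _ _ S(2,3)])
  define C1 where "C1 = (\<lambda>q. Complex (L1 (fst q)) (L1 (snd q)))"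
  define D where "D = C1 -` {z. Re z > -1}"
  have C1: "sep_hol UNIV C1" unfolding C1_def by (rule sep_hol_linear[OF L(1)])
  show "open D"
    unfolding D_def using sep_hol_imp_continuous_on[OF C1]
    by (intro open_vimage) (auto intro: open_halfspace_Re_gt)
  have "(\<lambda>z. csqrt (1 + z)) holomorphic_on {z. Re z > -1}"
    by (intro holomorphic_intros) (auto simp: complex_nonpos_Reals_iff)
  thus "sep_hol D (\<lambda>q. csqrt (1 + C1 q))"
    using sep_hol_subset[OF C1] by (intro sep_hol_compose[of _ C1 "\<lambda>z. csqrt (1 + z)"]) (auto simp: D_def)
  show "Re (csqrt (1 + C1 q)) \<ge> 0" for q by (rule Re_csqrt)
  have C1_real: "C1 (x, 0) = of_real (L1 x)" for x
    using L by (simp add: C1_def complex_of_real_def linear_0 bounded_linear.linear)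
  show "(x, 0) \<in> D" "csqrt (1 + C1 (x, 0)) = of_real (sqrt (1 + L1 x))" if "x \<in> S" for x
    using S(1)[OF that] by (simp_all add: D_def C1_real)
qed

lemma frob_sum_nonzero_Jset:
  assumes "(c1, c2, c3) \<in> Jset"
  shows "frob_sum (sqrt (1 + c1)) c2 c3 \<noteq> 0"
proof -
  have "sqrt (1 + c1) \<ge> 0" using assms by (simp add: Jset_def)
  from frob_fun_at_1(1)[OF this, of c2 c3] bspec[OF frob_fun_pos_Jset[OF assms], of 1] show ?thesis by simp
qed

lemma Jset_swap: "(c1, c2, c3) \<in> Jset \<longleftrightarrow> (c2, c1, c3) \<in> Jset"
  by (auto simp: Jset_def c3bar_def add.commute)

theorem theorem1p4:
  shows "smooth_on (Jset - {c. fst c = -1}) gamma_plus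
       \<and> smooth_on {(c2, c3). (-1, c2, c3) \<in> Jset} (\<lambda>(c2, c3). gamma_plus (-1, c2, c3))
       \<and> smooth_on (Jset - {c. fst (snd c) = -1}) gamma_minus
       \<and> smooth_on {(c1, c3). (c1, -1, c3) \<in> Jset} (\<lambda>(c1, c3). gamma_minus (c1, -1, c3))"
proof (intro conjI)
  note bl = bounded_linear_fst bounded_linear_snd
    bounded_linear_compose[OF bounded_linear_fst bounded_linear_snd]
    bounded_linear_compose[OF bounded_linear_snd bounded_linear_snd]
  show "smooth_on (Jset - {c. fst c = -1}) gamma_plus"
  proof (rule smooth_on_frob_gamma_sqrt[OF bl(1,3,4), where \<sigma> = 1])
    fix c assume c: "c \<in> Jset - {c. fst c = -1}"
    obtain c1 c2 c3 where [simp]: "c = (c1, c2, c3)" by (cases c)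
    show "fst c > -1" using c by (auto simp: Jset_def)
    show "frob_sum (sqrt (1 + fst c)) (fst (snd c)) (snd (snd c)) \<noteq> 0"
      using c frob_sum_nonzero_Jset by simp
    show "gamma_plus c = 1 * frob_gamma (sqrt (1 + fst c)) (fst (snd c)) (snd (snd c))"
      using c gamma_plus_eq by simp
  qed
  show "smooth_on (Jset - {c. fst (snd c) = -1}) gamma_minus"
  \<comment> \<open>Reflection exchanges the roles of c_1 and c_2 and contributes the sign
    -1.\<close>
  proof (rule smooth_on_frob_gamma_sqrt[OF bl(3,1,4), where \<sigma> = "-1"])
    fix c assume c: "c \<in> Jset - {c. fst (snd c) = -1}"
    obtain c1 c2 c3 where [simp]: "c = (c1, c2, c3)" by (cases c)
    show "fst (snd c) > -1" using c by (auto simp: Jset_def)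
    show "frob_sum (sqrt (1 + fst (snd c))) (fst c) (snd (snd c)) \<noteq> 0"
      using c frob_sum_nonzero_Jset[of c2 c1 c3] Jset_swap by simp
    show "gamma_minus c = -1 * frob_gamma (sqrt (1 + fst (snd c))) (fst c) (snd (snd c))"
      using c gamma_minus_eq by simp
  qed
  show "smooth_on {(c2, c3). (-1, c2, c3) \<in> Jset} (\<lambda>(c2, c3). gamma_plus (-1, c2, c3))"
  \<comment> \<open>On this face a = 0 throughout, so no root has to be continued and the constant
    \<open>A = 0\<close> works on the whole space.\<close>
  proof (rule smooth_on_frob_gamma[where A = "\<lambda>_. 0" and a = "\<lambda>_. 0" and D = UNIV and \<sigma> = 1, OF _ _ _ bl(1,2)])
    fix c :: "real \<times> real" assume c: "c \<in> {(c2, c3). (-1, c2, c3) \<in> Jset}"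
    show "frob_sum 0 (fst c) (snd c) \<noteq> 0"
      using c frob_sum_nonzero_Jset[of "-1" "fst c" "snd c"] by auto
    show "(case c of (c2, c3) \<Rightarrow> gamma_plus (-1, c2, c3)) = 1 * frob_gamma 0 (fst c) (snd c)"
      using c gamma_plus_eq[of "-1" "fst c" "snd c"] by auto
  qed (auto intro: sep_hol_const)
  show "smooth_on {(c1, c3). (c1, -1, c3) \<in> Jset} (\<lambda>(c1, c3). gamma_minus (c1, -1, c3))"
  proof (rule smooth_on_frob_gamma[where A = "\<lambda>_. 0" and a = "\<lambda>_. 0" and D = UNIV and \<sigma> = "-1", OF _ _ _ bl(1,2)])
    fix c :: "real \<times> real" assume c: "c \<in> {(c1, c3). (c1, -1, c3) \<in> Jset}"
    show "frob_sum 0 (fst c) (snd c) \<noteq> 0"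
      using c frob_sum_nonzero_Jset[of "-1" "fst c" "snd c"] Jset_swap by auto
    show "(case c of (c1, c3) \<Rightarrow> gamma_minus (c1, -1, c3)) = -1 * frob_gamma 0 (fst c) (snd c)"
      using c gamma_minus_eq[of "fst c" "-1" "snd c"] by auto
  qed (auto intro: sep_hol_const)
qed

end
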